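(* Let $R$ be a Noetherian super-ring with $\mathrm{Kdim}(R_0)<\infty$, let $I$ be a superideal of $R$ contained in the nilradical $\mathsf{rad}(R)$ of $R$, and let $M$ be a nonzero finitely generated $R$-supermodule. Then $$\mathrm{sdim}_0(M)=\mathrm{sdim}_0(\mathsf{gr}_I(M))\quad\text{and}\quad \mathrm{sdim}_1(M)\ge \mathrm{sdim}_1(\mathsf{gr}_I(M)),$$ where $\mathsf{gr}_I(M)$ is regarded as a supermodule over $\mathsf{gr}_I(R)$.
   Context: A super-ring is a unital associative $\mathbb{Z}_2$-graded ring $R=R_0\oplus R_1$; all super-rings are super-commutative ($ab=(-1)^{|a||b|}ba$ for homogeneous $a,b$, and $a^2=0$ for odd $a$). Superideals are $\mathbb{Z}_2$-graded ideals; supermodules are $\mathbb{Z}_2$-graded modules. Noetherian means the ascending chain condition on superideals. The nilradical of $R$ is the superideal $\sqrt{0_{R_0}}\oplus R_1$ (the intersection of all prime superideals). For a Noetherian super-ring $S$ with $\mathrm{Kdim}(S_0)<\infty$ and a nonzero $S$-supermodule $N$: $\dim(N)=\mathrm{Kdim}(S_0/\mathrm{Ann}_{S_0}(N))$ (with $\dim(0)=-\infty$); $\mathrm{sdim}_0(N)=\dim(N)$; a collection $y_1,\dots,y_l\in S_1$ ($l\ge1$) is a system of odd parameters of $N$ if $\dim(y_1\cdots y_l N)=\dim(N)$; $\mathrm{sdim}_1(N)$ is the largest length $l$ of a system of odd parameters of $N$, or $0$ if there is none. $\mathsf{gr}_I(R)=\bigoplus_{n\ge0}I^n/I^{n+1}$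 is a super-ring (again Noetherian with even part of finite Krull dimension) and $\mathsf{gr}_I(M)=\bigoplus_{n\ge0}I^nM/I^{n+1}M$ is a $\mathsf{gr}_I(R)$-supermodule. *)

theory Defs
  imports "HOL-Algebra.Module" "HOL-Algebra.Ideal_Product" "HOL-Algebra.QuotRing"
    "HOL-Algebra.Generated_Groups" "HOL-Library.Z2" "HOL-Library.Extended_Real"
begin

section \<open>Super-rings and supermodules\<close>

text \<open>The degree group is \<^typ>\<open>bit\<close>, the integers modulo 2.\<close>

definition z2_grading :: "('b, 'm) ring_scheme \<Rightarrow> (bit \<Rightarrow> 'b set) \<Rightarrow> bool" where
  "z2_grading G P \<longleftrightarrow>
     (\<forall>p. additive_subgroup (P p) G) \<and>
     P 0 \<inter> P 1 = {\<zero>\<^bsub>G\<^esub>} \<and>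
     set_add G (P 0) (P 1) = carrier G"

record 'a super_ring = "'a ring" +
  rpart :: "bit \<Rightarrow> 'a set"

record ('a, 'b) super_module = "('a, 'b) module" +
  mpart :: "bit \<Rightarrow> 'b set"

locale super_ring = ring R for R :: "('a, 'm) super_ring_scheme" (structure) +
  assumes grading: "z2_grading R (rpart R)"
    and part_mult: "\<lbrakk> a \<in> rpart R p; b \<in> rpart R q \<rbrakk> \<Longrightarrow> a \<otimes> b \<in> rpart R (p + q)"
    and super_comm: "\<lbrakk> a \<in> rpart R p; b \<in> rpart R q \<rbrakk> \<Longrightarrow>
          a \<otimes> b = (if p = 1 \<and> q = 1 then \<ominus> (b \<otimes> a) else b \<otimes> a)"
    and odd_square: "a \<in> rpart R 1 \<Longrightarrow> a \<otimes> a = \<zero>"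

text \<open>Left supermodules. The library locale \<^locale>\<open>module\<close> cannot be reused, since it demands a
  commutative ring of scalars.\<close>

locale super_module = R?: super_ring R + M?: abelian_group M
  for R :: "('a, 'm) super_ring_scheme" (structure)
    and M :: "('a, 'b, 'n) super_module_scheme" (structure) +
  assumes smult_closed: "\<lbrakk> a \<in> carrier R; x \<in> carrier M \<rbrakk> \<Longrightarrow> a \<odot>\<^bsub>M\<^esub> x \<in> carrier M"
    and smult_l_distr: "\<lbrakk> a \<in> carrier R; b \<in> carrier R; x \<in> carrier M \<rbrakk> \<Longrightarrow>
          (a \<oplus>\<^bsub>R\<^esub> b) \<odot>\<^bsub>M\<^esub> x = a \<odot>\<^bsub>M\<^esub> x \<oplus>\<^bsub>M\<^esub> b \<odot>\<^bsub>M\<^esub> x"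
    and smult_r_distr: "\<lbrakk> a \<in> carrier R; x \<in> carrier M; y \<in> carrier M \<rbrakk> \<Longrightarrow>
          a \<odot>\<^bsub>M\<^esub> (x \<oplus>\<^bsub>M\<^esub> y) = a \<odot>\<^bsub>M\<^esub> x \<oplus>\<^bsub>M\<^esub> a \<odot>\<^bsub>M\<^esub> y"
    and smult_assoc: "\<lbrakk> a \<in> carrier R; b \<in> carrier R; x \<in> carrier M \<rbrakk> \<Longrightarrow>
          (a \<otimes>\<^bsub>R\<^esub> b) \<odot>\<^bsub>M\<^esub> x = a \<odot>\<^bsub>M\<^esub> (b \<odot>\<^bsub>M\<^esub> x)"
    and smult_one: "x \<in> carrier M \<Longrightarrow> \<one>\<^bsub>R\<^esub> \<odot>\<^bsub>M\<^esub> x = x"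
    and mgrading: "z2_grading M (mpart M)"
    and part_smult: "\<lbrakk> a \<in> rpart R p; x \<in> mpart M q \<rbrakk> \<Longrightarrow> a \<odot>\<^bsub>M\<^esub> x \<in> mpart M (p + q)"

definition superideal :: "'a set \<Rightarrow> ('a, 'm) super_ring_scheme \<Rightarrow> bool" where
  "superideal I R \<longleftrightarrow> ideal I R \<and> set_add R (I \<inter> rpart R 0) (I \<inter> rpart R 1) = I"

locale noetherian_super_ring = super_ring R for R :: "('a, 'm) super_ring_scheme" (structure) +
  assumes acc: "\<lbrakk> \<And>n. superideal (J n) R; \<And>n. J n \<subseteq> J (Suc n) \<rbrakk> \<Longrightarrow> \<exists>N. \<forall>n\<ge>N. J n = J N"

definition fin_gen :: "('a, 'm) ring_scheme \<Rightarrow> ('a, 'b, 'n) module_scheme \<Rightarrow> bool" where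
  "fin_gen R M \<longleftrightarrow>
     (\<exists>A. finite A \<and> A \<subseteq> carrier M \<and> (\<forall>N. submodule N R M \<and> A \<subseteq> N \<longrightarrow> N = carrier M))"

definition nilrad :: "('a, 'm) super_ring_scheme \<Rightarrow> 'a set" where
  "nilrad R = set_add R {a \<in> rpart R 0. \<exists>n::nat. a [^]\<^bsub>R\<^esub> n = \<zero>\<^bsub>R\<^esub>} (rpart R 1)"

definition even_ring :: "('a, 'm) super_ring_scheme \<Rightarrow> ('a, 'm) super_ring_scheme" where
  "even_ring R = R\<lparr>carrier := rpart R 0\<rparr>"


section \<open>Dimensions\<close>

text \<open>The Krull dimension of a commutative ring; the zero ring, which has no prime ideals,
  gets \<open>-\<infinity>\<close>.\<close>

definition Kdim :: "('a, 'm) ring_scheme \<Rightarrow> ereal" where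
  "Kdim A = (SUP n \<in> {n. \<exists>P :: nat \<Rightarrow> 'a set.
      (\<forall>i\<le>n. primeideal (P i) A) \<and> (\<forall>i<n. P i \<subset> P (Suc i))}. ereal (real n))"

definition ann_even :: "('a, 'm) super_ring_scheme \<Rightarrow> ('a, 'b, 'n) module_scheme \<Rightarrow> 'a set" where
  "ann_even S N = {s \<in> rpart S 0. \<forall>x \<in> carrier N. s \<odot>\<^bsub>N\<^esub> x = \<zero>\<^bsub>N\<^esub>}"

definition sm_dim :: "('a, 'm) super_ring_scheme \<Rightarrow> ('a, 'b, 'n) module_scheme \<Rightarrow> ereal" where
  "sm_dim S N = (if carrier N = {\<zero>\<^bsub>N\<^esub>} then -\<infinity> else Kdim (even_ring S Quot ann_even S N))"

definition sdim0 :: "('a, 'm) super_ring_scheme \<Rightarrow> ('a, 'b, 'n) module_scheme \<Rightarrow> ereal" where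
  "sdim0 S N = sm_dim S N"

text \<open>The submodule \<open>y\<^sub>1 \<cdots> y\<^sub>l N\<close> keeps the operations of \<open>N\<close>; only its carrier shrinks.\<close>

definition odd_params ::
    "('a, 'm) super_ring_scheme \<Rightarrow> ('a, 'b, 'n) module_scheme \<Rightarrow> 'a list \<Rightarrow> bool" where
  "odd_params S N ys \<longleftrightarrow> ys \<noteq> [] \<and> set ys \<subseteq> rpart S 1 \<and>
     sm_dim S (N\<lparr>carrier := (\<lambda>x. foldr (\<otimes>\<^bsub>S\<^esub>) ys \<one>\<^bsub>S\<^esub> \<odot>\<^bsub>N\<^esub> x) ` carrier N\<rparr>) = sm_dim S N"

text \<open>The largest length of a system of odd parameters. For a nonzero supermodule over a Noetherian
  super-ring these lengths are bounded, so that the supremum is a maximum; the supremum of the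
  empty set in \<^typ>\<open>enat\<close> is 0.\<close>

definition sdim1 :: "('a, 'm) super_ring_scheme \<Rightarrow> ('a, 'b, 'n) module_scheme \<Rightarrow> enat" where
  "sdim1 S N = (SUP ys \<in> {ys. odd_params S N ys}. enat (length ys))"


section \<open>Associated graded super-rings and supermodules\<close>

fun ideal_pow :: "('a, 'm) ring_scheme \<Rightarrow> 'a set \<Rightarrow> nat \<Rightarrow> 'a set" where
  "ideal_pow R I 0 = carrier R"
| "ideal_pow R I (Suc n) = ideal_prod R I (ideal_pow R I n)"

definition ideal_smult ::
    "('a, 'b, 'n) module_scheme \<Rightarrow> 'a set \<Rightarrow> 'b set" where
  "ideal_smult M J = generate (add_monoid M) {a \<odot>\<^bsub>M\<^esub> x | a x. a \<in> J \<and> x \<in> carrier M}"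

text \<open>For a decreasing filtration \<open>F\<close> of \<open>G\<close> by additive subgroups, the elements of
  \<open>\<Oplus>\<^sub>n F n / F (n+1)\<close> are the finitely supported sequences \<open>f\<close> of cosets, with
  \<open>f n\<close> in \<open>F n / F (n+1)\<close>; the zero of the \<open>n\<close>-th summand is the coset \<open>F (n+1)\<close>.\<close>

definition gr_carrier :: "('b, 'm) ring_scheme \<Rightarrow> (nat \<Rightarrow> 'b set) \<Rightarrow> (nat \<Rightarrow> 'b set) set" where
  "gr_carrier G F = {f. (\<forall>n. f n \<in> (\<lambda>x. F (Suc n) +>\<^bsub>G\<^esub> x) ` F n) \<and> finite {n. f n \<noteq> F (Suc n)}}"

text \<open>The grading modulo 2 of the associated graded object is induced by that of \<open>G\<close>; it is not
  the reduction modulo 2 of the index \<open>n\<close>.\<close>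

definition gr_part ::
    "('b, 'm) ring_scheme \<Rightarrow> (bit \<Rightarrow> 'b set) \<Rightarrow> (nat \<Rightarrow> 'b set) \<Rightarrow> bit \<Rightarrow> (nat \<Rightarrow> 'b set) set" where
  "gr_part G P F p =
     {f \<in> gr_carrier G F. \<forall>n. f n \<in> (\<lambda>x. F (Suc n) +>\<^bsub>G\<^esub> x) ` (F n \<inter> P p)}"

definition gr_ring :: "('a, 'm) super_ring_scheme \<Rightarrow> 'a set \<Rightarrow> (nat \<Rightarrow> 'a set) super_ring" where
  "gr_ring R I =
     \<lparr>carrier = gr_carrier R (ideal_pow R I),
      mult = (\<lambda>f g n. \<Oplus>\<^bsub>R Quot ideal_pow R I (Suc n)\<^esub> i \<in> {..n}.
                rcoset_mult R (ideal_pow R I (Suc n)) (f i) (g (n - i))),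
      one = (\<lambda>n. if n = 0 then ideal_pow R I 1 +>\<^bsub>R\<^esub> \<one>\<^bsub>R\<^esub> else ideal_pow R I (Suc n)),
      zero = (\<lambda>n. ideal_pow R I (Suc n)),
      add = (\<lambda>f g n. set_add R (f n) (g n)),
      rpart = gr_part R (rpart R) (ideal_pow R I)\<rparr>"

text \<open>The analogue for scalar multiplication of the library's \<^const>\<open>rcoset_mult\<close>.\<close>

definition rcoset_smult ::
    "('a, 'b, 'n) module_scheme \<Rightarrow> 'b set \<Rightarrow> 'a set \<Rightarrow> 'b set \<Rightarrow> 'b set" where
  "rcoset_smult M H A X = (\<Union>a\<in>A. \<Union>x\<in>X. H +>\<^bsub>M\<^esub> (a \<odot>\<^bsub>M\<^esub> x))"

definition pow_smult ::
    "('a, 'm) ring_scheme \<Rightarrow> 'a set \<Rightarrow> ('a, 'b, 'n) module_scheme \<Rightarrow> nat \<Rightarrow> 'b set" where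
  "pow_smult R I M n = ideal_smult M (ideal_pow R I n)"

text \<open>The fields \<open>mult\<close> and \<open>one\<close>, which the library's module record inherits from rings, play no
  role. The sum defining \<open>smult\<close> is written as a \<^const>\<open>finprod\<close> because \<^const>\<open>A_FactGroup\<close>
  presents the additive quotient group as a (multiplicative) monoid record.\<close>

definition gr_module ::
    "('a, 'm) super_ring_scheme \<Rightarrow> 'a set \<Rightarrow> ('a, 'b, 'n) super_module_scheme \<Rightarrow>
     (nat \<Rightarrow> 'a set, nat \<Rightarrow> 'b set) super_module" where
  "gr_module R I M =
     \<lparr>carrier = gr_carrier M (pow_smult R I M),
      mult = undefined,
      one = undefined,
      zero = (\<lambda>n. pow_smult R I M (Suc n)),
      add = (\<lambda>f g n. set_add M (f n) (g n)),
      smult = (\<lambda>f x n. finprod (M A_Mod pow_smult R I M (Suc n))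
                (\<lambda>i. rcoset_smult M (pow_smult R I M (Suc n)) (f i) (x (n - i))) {..n}),
      mpart = gr_part M (mpart M) (pow_smult R I M)\<rparr>"

end

theory Submission
  imports Defs
begin

text \<open>
  A maximal nilpotent superideal contains every nilpotent homogeneous element, so \<open>I\<close> is nilpotent.
  Hence the positive part of \<open>gr\<^sub>I(R)\<close> is nilpotent, and the prime ideals of \<open>gr\<^sub>I(R)\<^sub>0\<close>
  correspond to those of \<open>R\<^sub>0/I\<^sub>0\<close>, i.e. to those of \<open>R\<^sub>0\<close>. If \<open>f\<close> annihilates \<open>gr\<^sub>I(M)\<close>,
  then a lift of its component of degree 0 sends \<open>I\<^sup>nM\<close> into \<open>I\<^sup>n\<^sup>+\<^sup>1M\<close>, so a power of it annihilates \<open>M\<close>;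
  therefore primes over the two annihilators correspond, too, which is the equality of dimensions.

  For the odd dimension let \<open>P\<close> be the smallest member of a maximal chain of primes over the
  annihilator of \<open>f\<^sub>1\<cdots>f\<^sub>l gr\<^sub>I(M)\<close>, and \<open>p\<close> the corresponding prime of \<open>R\<^sub>0\<close>. Unless \<open>p\<close> contains
  the annihilator of \<open>y\<^sub>1\<cdots>y\<^sub>l M\<close> for some odd \<open>y\<^sub>1, \<dots>, y\<^sub>l\<close>, each component of \<open>f\<^sub>1\<cdots>f\<^sub>l\<close> has a
  representative killed on \<open>M\<close> by an element outside \<open>p\<close>; the product of these finitely many
  elements then annihilates \<open>f\<^sub>1\<cdots>f\<^sub>l gr\<^sub>I(M)\<close> and lies in \<open>p\<close>, a contradiction.
\<close>

section \<open>Chains of prime ideals\<close>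

text \<open>What shapes the second half is that a product of odd elements of the graded ring has
  components which are sums of words \<open>y_1 ... y_l\<close> in odd elements of \<open>R\<close>,
  whereas a system of odd parameters of \<open>M\<close> is a single word. Dimension does not pass
  from a sum to one of its summands, but a prime does: if every word is annihilated on
  \<open>M\<close> by some element outside \<open>p\<close>, so is every sum of words, because the
  complement of \<open>p\<close> is closed under products. Hence the reduction of the dimension to
  one prime at the bottom of a longest chain, and the indirect argument for the existence of a good
  word.

  Chains are taken in one ring, above a given ideal, instead of in quotient rings. Annihilators of
  different submodules can then be compared by inclusion. Since a dimension sees the graded ring
  only through its even part, it is this part, with its action on the graded module, whose ring and
  module axioms are established.\<close>

definition prime_chain :: "('a, 'm) ring_scheme \<Rightarrow> 'a set \<Rightarrow> nat \<Rightarrow> bool" where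
  "prime_chain A J n \<longleftrightarrow>
     (\<exists>P :: nat \<Rightarrow> 'a set. (\<forall>i\<le>n. primeideal (P i) A \<and> J \<subseteq> P i) \<and> (\<forall>i<n. P i \<subset> P (Suc i)))"

text \<open>Only a map of primes that preserves strict inclusion is asked for, not an inverse. Two
  such maps in opposite directions already make two dimensions equal.\<close>

lemma prime_chain_transfer:
  assumes "prime_chain A J n"
    and "\<And>P. primeideal P A \<Longrightarrow> J \<subseteq> P \<Longrightarrow> primeideal (\<phi> P) B \<and> K \<subseteq> \<phi> P"
    and "\<And>P Q. primeideal P A \<Longrightarrow> J \<subseteq> P \<Longrightarrow> primeideal Q A \<Longrightarrow> P \<subset> Q \<Longrightarrow> \<phi> P \<subset> \<phi> Q"
  shows "prime_chain B K n"
proof -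
  obtain P where "\<forall>i\<le>n. primeideal (P i) A \<and> J \<subseteq> P i" "\<forall>i<n. P i \<subset> P (Suc i)"
    using assms(1) unfolding prime_chain_def by blast
  then have "(\<forall>i\<le>n. primeideal (\<phi> (P i)) B \<and> K \<subseteq> \<phi> (P i)) \<and> (\<forall>i<n. \<phi> (P i) \<subset> \<phi> (P (Suc i)))"
    using assms(2,3) by (metis Suc_leI less_or_eq_imp_le)
  then show ?thesis
    unfolding prime_chain_def by (intro exI[of _ "\<lambda>i. \<phi> (P i)"])
qed

lemma prime_chain_antimono:
  assumes "prime_chain A J n" "K \<subseteq> J"
  shows "prime_chain A K n"
  using assms by (auto intro!: prime_chain_transfer[of A J n "\<lambda>P. P" A K])

text \<open>Whether a chain lies above an ideal is decided at its smallest member. A question about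
  the whole chain thereby becomes a question about one prime.\<close>

lemma prime_chain_start:
  assumes "prime_chain A J n"
  obtains P where "primeideal P A" "J \<subseteq> P" "\<And>K. K \<subseteq> P \<Longrightarrow> prime_chain A K n"
proof -
  obtain P where P: "\<forall>i\<le>n. primeideal (P i) A \<and> J \<subseteq> P i" "\<forall>i<n. P i \<subset> P (Suc i)"
    using assms unfolding prime_chain_def by blast
  have le: "i \<le> n \<Longrightarrow> P 0 \<subseteq> P i" for i
  proof (induction i)
    case (Suc i)
    then show ?case using P(2) by (meson Suc_leD Suc_le_lessD psubset_imp_subset subset_trans)
  qed simp
  show thesis
  proof (rule that[of "P 0"])
    show "prime_chain A K n" if "K \<subseteq> P 0" for K
      unfolding prime_chain_def by (intro exI[of _ P]) (use P le that in blast)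
  qed (use P in auto)
qed

lemma Kdim_eq_prime_chain: "Kdim A = (SUP n \<in> {n. prime_chain A {} n}. ereal (real n))"
  by (simp add: Kdim_def prime_chain_def)

text \<open>Primes of the quotient correspond to primes above \<open>J\<close> by image and preimage
  under the projection. An improper \<open>J\<close> is covered: there are no chains on either side,
  and both suprema are over the empty set.\<close>

lemma (in cring) Kdim_Quot:
  assumes J: "ideal J R"
  shows "Kdim (R Quot J) = (SUP n \<in> {n. prime_chain R J n}. ereal (real n))"
proof -
  let ?Q = "R Quot J"
  have hom: "ring_hom_ring R ?Q ((+>) J)"
    by (rule ideal.rcos_ring_hom_ring[OF J])
  have Qcring: "cring ?Q"
    by (rule ideal.quotient_is_cring[OF J is_cring])
  have Qcarr: "carrier ?Q = (+>) J ` carrier R"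
    by (auto simp: FactRing_def A_RCOSETS_def')
  have mem: "J +> a \<in> (+>) J ` P \<longleftrightarrow> a \<in> P"
    if P: "ideal P R" "J \<subseteq> P" and a: "a \<in> carrier R" for P a
  proof -
    have "(+>) J ` P \<subseteq> carrier ?Q"
      using P(1) unfolding Qcarr by (auto dest: ideal.Icarr)
    then have "J +> a \<in> (+>) J ` P \<longleftrightarrow> a \<in> \<Union> ((+>) J ` P)"
      by (rule canonical_proj_vimage_mem_iff[OF J _ a, symmetric])
    also have "\<Union> ((+>) J ` P) = P"
      using ideal_incl_iff[OF J P(1)] P(2) by simp
    finally show ?thesis .
  qed
  have img: "primeideal ((+>) J ` P) ?Q" if P: "primeideal P R" "J \<subseteq> P" for P
  proof -
    interpret P: primeideal P R by fact
    show ?thesis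
    proof (rule primeidealI[OF ring_ideal_imp_quot_ideal[OF J P.is_ideal] Qcring])
      show "carrier ?Q \<noteq> (+>) J ` P"
        using mem[OF P.is_ideal P(2) one_closed] P.I_notcarr P.one_imp_carrier
        unfolding Qcarr by (metis imageI one_closed)
    next
      fix x y assume "x \<in> carrier ?Q" "y \<in> carrier ?Q" and xy: "x \<otimes>\<^bsub>?Q\<^esub> y \<in> (+>) J ` P"
      then obtain a b where ab: "a \<in> carrier R" "b \<in> carrier R" "x = J +> a" "y = J +> b"
        unfolding Qcarr by blast
      with xy have "J +> (a \<otimes> b) \<in> (+>) J ` P"
        using ring_hom_mult[OF ideal.rcos_ring_hom[OF J]] by simp
      then show "x \<in> (+>) J ` P \<or> y \<in> (+>) J ` P"
        using ab mem[OF P.is_ideal P(2)] P.I_prime by auto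
    qed
  qed
  have "prime_chain ?Q {} n \<longleftrightarrow> prime_chain R J n" for n
  proof
    assume "prime_chain ?Q {} n"
    then show "prime_chain R J n"
    proof (rule prime_chain_transfer[where \<phi> = "\<lambda>P. {a \<in> carrier R. J +> a \<in> P}"])
      fix P assume P: "primeideal P ?Q"
      have "J +> a \<in> P" if "a \<in> J" for a
        using additive_subgroup.zero_closed[OF ideal.axioms(1)[OF primeideal.axioms(1)[OF P]]]
          abelian_subgroup.a_rcos_const[OF abelian_subgroupI3[OF ideal.axioms(1)[OF J]]] that
        by (simp add: FactRing_def is_abelian_group)
      then show "primeideal {a \<in> carrier R. J +> a \<in> P} R \<and> J \<subseteq> {a \<in> carrier R. J +> a \<in> P}"
        using ring_hom_ring.primeideal_vimage[OF hom is_cring P] ideal.Icarr[OF J] by auto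
    next
      fix P Q assume "primeideal P ?Q" "primeideal Q ?Q" and PQ: "P \<subset> Q"
      then have "Q \<subseteq> carrier ?Q"
        by (meson additive_subgroup.a_subset ideal.axioms(1) primeideal.axioms(1))
      with PQ show "{a \<in> carrier R. J +> a \<in> P} \<subset> {a \<in> carrier R. J +> a \<in> Q}"
        unfolding Qcarr by blast
    qed
  next
    assume "prime_chain R J n"
    then show "prime_chain ?Q {} n"
    proof (rule prime_chain_transfer[where \<phi> = "\<lambda>P. (+>) J ` P"])
      fix P Q assume P: "primeideal P R" "J \<subseteq> P" and Q: "primeideal Q R" and PQ: "P \<subset> Q"
      then obtain a where a: "a \<in> Q" "a \<notin> P" by blast
      then have "J +> a \<notin> (+>) J ` P"
        using mem[OF primeideal.axioms(1)[OF P(1)] P(2)] ideal.Icarr[OF primeideal.axioms(1)[OF Q]]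
        by blast
      with a PQ show "(+>) J ` P \<subset> (+>) J ` Q" by blast
    qed (use img in auto)
  qed
  then show ?thesis
    by (simp add: Kdim_eq_prime_chain)
qed

no_notation Sum_Type.Plus (infixr \<open><+>\<close> 65)

section \<open>Super-rings\<close>

context super_ring begin

lemma rpart_additive_subgroup: "additive_subgroup (rpart R p) R"
  using grading unfolding z2_grading_def by blast

lemma rpart_carrier: "a \<in> rpart R p \<Longrightarrow> a \<in> carrier R"
  by (rule additive_subgroup.a_Hcarr[OF rpart_additive_subgroup])

lemmas rpart_add = additive_subgroup.a_closed[OF rpart_additive_subgroup]
  and rpart_zero = additive_subgroup.zero_closed[OF rpart_additive_subgroup]
  and rpart_neg = additive_subgroup.a_inv_closed[OF rpart_additive_subgroup]

lemma rpart_disjoint: "a \<in> rpart R 0 \<Longrightarrow> a \<in> rpart R 1 \<Longrightarrow> a = \<zero>"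
  using grading unfolding z2_grading_def by blast

lemma rpart_decomp:
  assumes "a \<in> carrier R"
  obtains a0 a1 where "a0 \<in> rpart R 0" "a1 \<in> rpart R 1" "a = a0 \<oplus> a1"
proof -
  have "a \<in> rpart R 0 <+> rpart R 1"
    using grading assms unfolding z2_grading_def by auto
  then show thesis
    using that by (auto simp: set_add_def')
qed

text \<open>Evenness of the unit follows from the axioms. If \<open>\<one> = e \<oplus> u\<close>,
  multiplying by \<open>e\<close> shows that \<open>e \<otimes> u\<close> is even as well as odd,
  hence zero; multiplying by \<open>u\<close> and using \<open>u \<otimes> u = \<zero>\<close> then
  gives \<open>u = \<zero>\<close>.\<close>

lemma one_even: "\<one> \<in> rpart R 0"
proof -
  obtain e u where e: "e \<in> rpart R 0" and u: "u \<in> rpart R 1" and eu: "\<one> = e \<oplus> u"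
    using rpart_decomp[OF one_closed] .
  note c = rpart_carrier[OF e] rpart_carrier[OF u]
  have "e = e \<otimes> (e \<oplus> u)" using c by (simp flip: eu)
  then have "e = e \<otimes> e \<oplus> e \<otimes> u" using c by (simp add: r_distr)
  then have "e \<otimes> u = e \<oplus> \<ominus> (e \<otimes> e)"
    using c by (metis a_comm add.inv_solve_right m_closed)
  then have "e \<otimes> u = \<zero>"
    using rpart_disjoint[of "e \<otimes> u"] part_mult[OF e u] part_mult[OF e e] rpart_add[OF e] rpart_neg
    by simp
  moreover have "u = (e \<oplus> u) \<otimes> u" using c by (simp flip: eu)
  ultimately have "u = \<zero>"
    using c odd_square[OF u] by (simp add: l_distr)
  with eu e c show ?thesis by simp
qed

lemma even_comm:
  assumes a: "a \<in> rpart R 0" and r: "r \<in> carrier R"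
  shows "a \<otimes> r = r \<otimes> a"
proof -
  obtain r0 r1 where d: "r0 \<in> rpart R 0" "r1 \<in> rpart R 1" "r = r0 \<oplus> r1"
    using rpart_decomp[OF r] .
  show ?thesis
    using super_comm[OF a d(1)] super_comm[OF a d(2)] a d rpart_carrier by (simp add: l_distr r_distr)
qed

text \<open>Moving an odd \<open>x\<close> past \<open>s\<close> only changes the sign of the odd
  component of \<open>s\<close>. Therefore the left multiples of \<open>x\<close> form a two-sided
  ideal, and coefficients can be collected to the left of powers of \<open>x\<close>.\<close>

lemma homogeneous_normal:
  assumes x: "x \<in> rpart R p" and s: "s \<in> carrier R"
  obtains s' where "s' \<in> carrier R" "x \<otimes> s = s' \<otimes> x"
proof (cases "p = 0")
  case True
  then show thesis using that s even_comm x by blast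
next
  case False
  then have x: "x \<in> rpart R 1" using x by (metis (full_types) bit_not_zero_iff)
  obtain s0 s1 where d: "s0 \<in> rpart R 0" "s1 \<in> rpart R 1" "s = s0 \<oplus> s1"
    using rpart_decomp[OF s] .
  show thesis
  proof (rule that[of "s0 \<oplus> \<ominus> s1"])
    show "x \<otimes> s = (s0 \<oplus> \<ominus> s1) \<otimes> x"
      using d x by (simp add: l_distr r_distr rpart_carrier super_comm[of x _ s0] super_comm[of x _ s1] l_minus)
  qed (use d rpart_carrier in auto)
qed

lemma even_ring_cring: "cring (even_ring R)"
proof (rule cringI)
  show "abelian_group (even_ring R)"
  proof (rule abelian_groupI)
    fix x assume x: "x \<in> carrier (even_ring R)"
    show "\<exists>y\<in>carrier (even_ring R). y \<oplus>\<^bsub>even_ring R\<^esub> x = \<zero>\<^bsub>even_ring R\<^esub>"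
      by (rule bexI[of _ "\<ominus> x"])
        (use x rpart_neg rpart_carrier in \<open>auto simp: even_ring_def l_neg\<close>)
  qed (auto simp: even_ring_def rpart_add rpart_zero rpart_carrier a_ac)
  show "Group.comm_monoid (even_ring R)"
  proof (rule comm_monoidI)
    fix x y assume "x \<in> carrier (even_ring R)" "y \<in> carrier (even_ring R)"
    then show "x \<otimes>\<^bsub>even_ring R\<^esub> y = y \<otimes>\<^bsub>even_ring R\<^esub> x"
      by (simp add: even_ring_def even_comm rpart_carrier)
  qed (use part_mult[of _ 0 _ 0] one_even in \<open>auto simp: even_ring_def rpart_carrier m_assoc\<close>)
qed (auto simp: even_ring_def rpart_carrier l_distr)

end

section \<open>Annihilators and dimensions over the even part\<close>

lemma (in super_module) even_module: "Module.module (even_ring R) M"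
  by (rule Module.moduleI[OF even_ring_cring M.abelian_group_axioms])
    (auto simp: even_ring_def R.rpart_carrier smult_closed smult_l_distr smult_r_distr smult_assoc smult_one)

text \<open>Allowing any subset \<open>T\<close> covers the image of a multiplication map without
  first recognising it as a submodule.\<close>

lemma (in Module.module) ideal_annihilator:
  assumes T: "T \<subseteq> carrier M"
  shows "ideal {a \<in> carrier R. \<forall>x\<in>T. a \<odot>\<^bsub>M\<^esub> x = \<zero>\<^bsub>M\<^esub>} R" (is "ideal ?J R")
proof (rule idealI)
  show "subgroup ?J (add_monoid R)"
    using T by (intro R.add.subgroupI) (auto simp: smult_l_distr smult_l_minus subset_iff intro: R.zero_closed)
next
  fix a x assume ax: "a \<in> ?J" "x \<in> carrier R"
  then show "x \<otimes> a \<in> ?J"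
    using T by (auto simp: smult_assoc1 subset_iff)
  then show "a \<otimes> x \<in> ?J"
    using ax R.m_comm by auto
qed (rule R.ring_axioms)

lemma ann_even_eq:
  "ann_even S N = {a \<in> carrier (even_ring S). \<forall>x\<in>carrier N. a \<odot>\<^bsub>N\<^esub> x = \<zero>\<^bsub>N\<^esub>}"
  by (simp add: ann_even_def even_ring_def)

text \<open>For the zero module both sides are \<open>-\<infinity>\<close>: its annihilator lies in no prime ideal.\<close>

lemma sm_dim_eq_prime_chain:
  assumes mod: "Module.module (even_ring S) N" and T: "T \<subseteq> carrier N"
  shows "sm_dim S (N\<lparr>carrier := T\<rparr>) =
    (SUP n \<in> {n. prime_chain (even_ring S) (ann_even S (N\<lparr>carrier := T\<rparr>)) n}. ereal (real n))"
proof -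
  interpret Module.module "even_ring S" N by fact
  let ?J = "ann_even S (N\<lparr>carrier := T\<rparr>)"
  have J: "ideal ?J (even_ring S)"
    unfolding ann_even_eq using ideal_annihilator[OF T] by simp
  show ?thesis
  proof (cases "T = {\<zero>\<^bsub>N\<^esub>}")
    case True
    then have "?J = carrier (even_ring S)"
      unfolding ann_even_eq by auto
    then have no: "\<not> prime_chain (even_ring S) ?J n" for n
      using primeideal.I_notcarr ideal.Icarr[OF primeideal.axioms(1)]
      by (metis prime_chain_start subsetI subset_antisym)
    have "sm_dim S (N\<lparr>carrier := T\<rparr>) = -\<infinity>"
      using True by (simp add: sm_dim_def)
    then show ?thesis
      using no by (simp add: bot_ereal_def)
  next
    case False
    then show ?thesis
      using R.Kdim_Quot[OF J] by (simp add: sm_dim_def)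
  qed
qed

section \<open>Nilpotency of superideals inside the nilradical\<close>

text \<open>Words over an arbitrary set can be cut into blocks and extended by a letter, whereas
  elements of an ideal power are sums and would call for an induction at each use.\<close>

definition (in ring) word_nilpotent :: "'a set \<Rightarrow> nat \<Rightarrow> bool" where
  "word_nilpotent J n \<longleftrightarrow> (\<forall>xs. set xs \<subseteq> J \<and> length xs = n \<longrightarrow> foldr (\<otimes>) xs \<one> = \<zero>)"

context ring begin

lemma foldr_mult_closed: "set xs \<subseteq> carrier R \<Longrightarrow> foldr (\<otimes>) xs \<one> \<in> carrier R"
  by (induction xs) auto

lemma foldr_mult_append:
  "set xs \<subseteq> carrier R \<Longrightarrow> set ys \<subseteq> carrier R \<Longrightarrow>
    foldr (\<otimes>) (xs @ ys) \<one> = foldr (\<otimes>) xs \<one> \<otimes> foldr (\<otimes>) ys \<one>"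
proof (induction xs)
  case Nil
  then show ?case using foldr_mult_closed[of ys] by simp
next
  case (Cons x xs)
  then have "x \<in> carrier R" "foldr (\<otimes>) xs \<one> \<in> carrier R" "foldr (\<otimes>) ys \<one> \<in> carrier R"
    and IH: "foldr (\<otimes>) (xs @ ys) \<one> = foldr (\<otimes>) xs \<one> \<otimes> foldr (\<otimes>) ys \<one>"
    by (auto intro: foldr_mult_closed)
  then show ?case
    using m_assoc by (simp del: foldr_append)
qed

text \<open>A word of length \<open>m * k\<close> is cut into \<open>m\<close> blocks of length
  \<open>k\<close>. Their products lie in \<open>J\<close> and form a word of length
  \<open>m\<close> over \<open>J\<close>, which vanishes.\<close>

lemma word_nilpotent_trans:
  assumes J: "word_nilpotent J m" and L: "L \<subseteq> carrier R"
    and LJ: "\<And>xs. set xs \<subseteq> L \<Longrightarrow> length xs = k \<Longrightarrow> foldr (\<otimes>) xs \<one> \<in> J"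
  shows "word_nilpotent L (m * k)"
proof -
  have "\<exists>ys. set ys \<subseteq> J \<and> length ys = n \<and> foldr (\<otimes>) xs \<one> = foldr (\<otimes>) ys \<one>"
    if "set xs \<subseteq> L" "length xs = n * k" for xs n
    using that
  proof (induction n arbitrary: xs)
    case (Suc n)
    have x: "set (take k xs) \<subseteq> L" "set (drop k xs) \<subseteq> L" "length (take k xs) = k"
      using Suc.prems by (auto dest: in_set_takeD in_set_dropD)
    obtain ys where "set ys \<subseteq> J" "length ys = n" "foldr (\<otimes>) (drop k xs) \<one> = foldr (\<otimes>) ys \<one>"
      using Suc.IH[OF x(2)] Suc.prems by auto
    moreover have "foldr (\<otimes>) xs \<one> = foldr (\<otimes>) (take k xs) \<one> \<otimes> foldr (\<otimes>) (drop k xs) \<one>"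
      using foldr_mult_append[of "take k xs" "drop k xs"] x L by auto
    ultimately show ?case
      using LJ[OF x(1,3)] by (intro exI[of _ "foldr (\<otimes>) (take k xs) \<one> # ys"]) auto
  qed auto
  then show ?thesis
    using J unfolding word_nilpotent_def by metis
qed

lemma ideal_pow_eq_zero:
  assumes I: "ideal I R" and nil: "word_nilpotent I N"
  shows "ideal_pow R I N = {\<zero>}"
proof -
  have ideal: "ideal (ideal_pow R I n) R" for n
    by (induction n) (auto simp: oneideal ideal_prod_is_ideal[OF I])
  have carr: "z \<in> ideal_pow R I n \<Longrightarrow> z \<in> carrier R" for z n
    using ideal.Icarr[OF ideal] .
  \<comment> \<open>The claim mixes words with ideal powers: lowering the exponent by one moves a
    factor from \<open>I\<close> to the end of the word, so the total length stays \<open>N\<close>.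
    The empty word with \<open>n = N\<close> gives the result.\<close>
  have "foldr (\<otimes>) xs \<one> \<otimes> z = \<zero>"
    if "z \<in> ideal_pow R I n" "set xs \<subseteq> I" "length xs + n = N" for xs z n
    using that
  proof (induction n arbitrary: xs z)
    case 0
    then show ?case
      using nil unfolding word_nilpotent_def by simp
  next
    case (Suc n)
    have xs: "set xs \<subseteq> carrier R"
      using Suc.prems(2) ideal.Icarr[OF I] by blast
    from Suc.prems(1) have "z \<in> ideal_prod R I (ideal_pow R I n)" by simp
    then show ?case
    proof induction
      case (prod i j)
      have "foldr (\<otimes>) (xs @ [i]) \<one> \<otimes> j = \<zero>"
        using Suc.IH[of j "xs @ [i]"] prod Suc.prems by auto
      then show ?case
        using foldr_mult_append[OF xs, of "[i]"] foldr_mult_closed[OF xs] prod carr ideal.Icarr[OF I]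
        by (auto simp: m_assoc)
    next
      case (sum s1 s2)
      then have "s1 \<in> carrier R" "s2 \<in> carrier R"
        using carr[of _ "Suc n"] by auto
      with sum show ?case
        using foldr_mult_closed[OF xs] by (simp add: r_distr)
    qed
  qed
  from this[of _ N "[]"] have "ideal_pow R I N \<subseteq> {\<zero>}"
    using carr by fastforce
  then show ?thesis
    using additive_subgroup.zero_closed[OF ideal.axioms(1)[OF ideal]] by blast
qed

end

context super_ring begin

text \<open>Two-sidedness comes from \<open>homogeneous_normal\<close>. For gradedness, a multiple
  \<open>r \<otimes> x\<close> is split along the components of \<open>r\<close>; if
  \<open>x\<close> is odd, they exchange parities.\<close>

lemma superideal_add_principal:
  assumes J: "superideal J R" and x: "x \<in> rpart R p"
  shows "superideal (J <+> (\<lambda>r. r \<otimes> x) ` carrier R) R" (is "superideal ?L R")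
proof -
  have Ji: "ideal J R" using J by (simp add: superideal_def)
  note Jc = ideal.Icarr[OF Ji]
  note xc = rpart_carrier[OF x]
  have Rx: "ideal ((\<lambda>r. r \<otimes> x) ` carrier R) R"
  proof (rule idealI[OF ring_axioms])
    show "subgroup ((\<lambda>r. r \<otimes> x) ` carrier R) (add_monoid R)"
    proof (rule add.subgroupI)
      fix a assume "a \<in> (\<lambda>r. r \<otimes> x) ` carrier R"
      then obtain r where "r \<in> carrier R" "a = r \<otimes> x" by blast
      then show "\<ominus> a \<in> (\<lambda>r. r \<otimes> x) ` carrier R"
        using xc by (intro image_eqI[of _ _ "\<ominus> r"]) (auto simp: l_minus)
    next
      fix a b assume "a \<in> (\<lambda>r. r \<otimes> x) ` carrier R" "b \<in> (\<lambda>r. r \<otimes> x) ` carrier R"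
      then obtain r s where "r \<in> carrier R" "a = r \<otimes> x" "s \<in> carrier R" "b = s \<otimes> x" by blast
      then show "a \<oplus> b \<in> (\<lambda>r. r \<otimes> x) ` carrier R"
        using xc by (intro image_eqI[of _ _ "r \<oplus> s"]) (auto simp: l_distr)
    qed (use xc in auto)
  next
    fix a s assume "a \<in> (\<lambda>r. r \<otimes> x) ` carrier R" and s: "s \<in> carrier R"
    then obtain r where r: "r \<in> carrier R" "a = r \<otimes> x" by blast
    then show "s \<otimes> a \<in> (\<lambda>r. r \<otimes> x) ` carrier R"
      using xc s by (intro image_eqI[of _ _ "s \<otimes> r"]) (auto simp: m_assoc)
    obtain s' where "s' \<in> carrier R" "x \<otimes> s = s' \<otimes> x"
      using homogeneous_normal[OF x s] .
    then show "a \<otimes> s \<in> (\<lambda>r. r \<otimes> x) ` carrier R"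
      using xc s r by (intro image_eqI[of _ _ "r \<otimes> s'"]) (auto simp: m_assoc)
  qed
  have L: "ideal ?L R" using add_ideals[OF Ji Rx] .
  have "?L \<subseteq> (?L \<inter> rpart R 0) <+> (?L \<inter> rpart R 1)"
  proof
    fix l assume "l \<in> ?L"
    then obtain j r where j: "j \<in> J" and r: "r \<in> carrier R" and l: "l = j \<oplus> r \<otimes> x"
      by (auto simp: set_add_def')
    have "j \<in> (J \<inter> rpart R 0) <+> (J \<inter> rpart R 1)"
      using J j by (simp add: superideal_def)
    then obtain j0 j1 where jd: "j0 \<in> J" "j0 \<in> rpart R 0" "j1 \<in> J" "j1 \<in> rpart R 1" "j = j0 \<oplus> j1"
      by (auto simp: set_add_def')
    obtain r0 r1 where rd: "r0 \<in> rpart R 0" "r1 \<in> rpart R 1" "r = r0 \<oplus> r1"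
      using rpart_decomp[OF r] .
    have c: "j0 \<in> carrier R" "j1 \<in> carrier R" "r0 \<in> carrier R" "r1 \<in> carrier R"
      using jd rd rpart_carrier by auto
    obtain s0 s1 where s: "s0 \<in> carrier R" "s1 \<in> carrier R" "s0 \<otimes> x \<in> rpart R 0" "s1 \<otimes> x \<in> rpart R 1"
      "r \<otimes> x = s0 \<otimes> x \<oplus> s1 \<otimes> x"
    proof (cases "p = 0")
      case True
      with x have "r0 \<otimes> x \<in> rpart R 0" "r1 \<otimes> x \<in> rpart R 1"
        using part_mult[OF rd(1) x] part_mult[OF rd(2) x] by auto
      then show thesis using that[of r0 r1] rd c xc by (simp add: l_distr)
    next
      case False
      then have "p = 1" by (metis (full_types) bit_not_zero_iff)
      with x have "r1 \<otimes> x \<in> rpart R 0" "r0 \<otimes> x \<in> rpart R 1"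
        using part_mult[OF rd(1) x] part_mult[OF rd(2) x] by auto
      then show thesis using that[of r1 r0] rd c xc by (simp add: l_distr a_comm)
    qed
    have "l = (j0 \<oplus> s0 \<otimes> x) \<oplus> (j1 \<oplus> s1 \<otimes> x)"
      using l jd s c xc by (simp add: a_ac)
    moreover have "j0 \<oplus> s0 \<otimes> x \<in> ?L \<inter> rpart R 0" "j1 \<oplus> s1 \<otimes> x \<in> ?L \<inter> rpart R 1"
      using jd s rpart_add by (auto simp: set_add_def')
    ultimately show "l \<in> (?L \<inter> rpart R 0) <+> (?L \<inter> rpart R 1)"
      by (auto simp: set_add_def')
  qed
  moreover have "(?L \<inter> rpart R 0) <+> (?L \<inter> rpart R 1) \<subseteq> ?L"
    using additive_subgroup.a_closed[OF ideal.axioms(1)[OF L]] by (auto simp: set_add_def'[of R "_ \<inter> _"])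
  ultimately show ?thesis
    using L by (auto simp: superideal_def)
qed

text \<open>Modulo \<open>J\<close> each letter is a multiple of \<open>x\<close>, and normality of
  \<open>x\<close> collects all coefficients on the left. A word of length \<open>k\<close> is thus
  congruent to a multiple of \<open>x [^] k = \<zero>\<close> and lies in \<open>J\<close>; cutting
  longer words into such blocks does the rest.\<close>

lemma word_nilpotent_add_principal:
  assumes J: "ideal J R" "word_nilpotent J m" and x: "x \<in> rpart R p" "x [^] (k::nat) = \<zero>"
  shows "word_nilpotent (J <+> (\<lambda>r. r \<otimes> x) ` carrier R) (m * k)" (is "word_nilpotent ?L _")
proof (rule word_nilpotent_trans[OF J(2)])
  note Jc = ideal.Icarr[OF J(1)]
  note xc = rpart_carrier[OF x(1)]
  show L: "?L \<subseteq> carrier R"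
    using Jc xc by (auto simp: set_add_def')
  have "\<exists>j\<in>J. \<exists>r\<in>carrier R. foldr (\<otimes>) xs \<one> = j \<oplus> r \<otimes> x [^] length xs" if "set xs \<subseteq> ?L" for xs
    using that
  proof (induction xs)
    case Nil
    have "\<zero> \<in> J"
      using additive_subgroup.zero_closed[OF ideal.axioms(1)[OF J(1)]] .
    moreover have "\<one> = \<zero> \<oplus> \<one> \<otimes> x [^] (0::nat)" by simp
    ultimately show ?case by (metis foldr_Nil id_apply list.size(3) one_closed)
  next
    case (Cons l xs)
    obtain j r where IH: "j \<in> J" "r \<in> carrier R" "foldr (\<otimes>) xs \<one> = j \<oplus> r \<otimes> x [^] length xs"
      using Cons by auto
    obtain i s where l: "i \<in> J" "s \<in> carrier R" "l = i \<oplus> s \<otimes> x"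
      using Cons.prems by (auto simp: set_add_def')
    obtain r' where r': "r' \<in> carrier R" "x \<otimes> r = r' \<otimes> x"
      using homogeneous_normal[OF x(1) IH(2)] .
    have pw: "x \<otimes> x [^] length xs = x [^] Suc (length xs)"
      using nat_pow_Suc2[OF xc] by simp
    have c: "i \<in> carrier R" "j \<in> carrier R" "x [^] length xs \<in> carrier R"
      using l IH Jc xc by auto
    let ?y = "x [^] length xs"
    have "l \<otimes> (j \<oplus> r \<otimes> ?y) = (i \<otimes> (j \<oplus> r \<otimes> ?y) \<oplus> s \<otimes> x \<otimes> j) \<oplus> s \<otimes> (x \<otimes> r) \<otimes> ?y"
      using l IH c xc by (simp add: l_distr r_distr m_assoc a_ac)
    also have "s \<otimes> (x \<otimes> r) \<otimes> ?y = (s \<otimes> r') \<otimes> x [^] Suc (length xs)"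
      unfolding r' pw[symmetric] using l r' c xc by (simp add: m_assoc)
    finally have "foldr (\<otimes>) (l # xs) \<one> =
        (i \<otimes> (j \<oplus> r \<otimes> ?y) \<oplus> s \<otimes> x \<otimes> j) \<oplus> (s \<otimes> r') \<otimes> x [^] Suc (length xs)"
      using IH by simp
    moreover have "i \<otimes> (j \<oplus> r \<otimes> ?y) \<oplus> s \<otimes> x \<otimes> j \<in> J"
      using l IH c xc ideal.I_l_closed[OF J(1)] ideal.I_r_closed[OF J(1)]
        additive_subgroup.a_closed[OF ideal.axioms(1)[OF J(1)]] by auto
    ultimately show ?case
      using l r' by (metis length_Cons m_closed)
  qed
  then show "foldr (\<otimes>) xs \<one> \<in> J" if "set xs \<subseteq> ?L" "length xs = k" for xs
    using that x(2) Jc by (metis r_null r_zero)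
qed

end

lemma (in noetherian_super_ring) ideal_pow_nilpotent:
  assumes I: "superideal I R" and nil: "I \<subseteq> nilrad R"
  shows "\<exists>N. ideal_pow R I N = {\<zero>}"
proof -
  define C where "C = {J. superideal J R \<and> (\<exists>m. word_nilpotent J m)}"
  have "{\<zero>} <+> {\<zero>} = {\<zero>}" by (simp add: set_add_def')
  then have zero: "{\<zero>} \<in> C"
    unfolding C_def superideal_def word_nilpotent_def
    using zeroideal rpart_zero by (auto intro!: exI[of _ "Suc 0"] simp: length_Suc_conv)
  \<comment> \<open>Otherwise dependent choice would build a strictly increasing sequence of
    nilpotent superideals, against the chain condition.\<close>
  have "\<exists>J\<in>C. \<forall>K\<in>C. \<not> J \<subset> K"
  proof (rule ccontr)
    assume "\<not> ?thesis"
    then have step: "\<And>J. J \<in> C \<Longrightarrow> \<exists>K. K \<in> C \<and> J \<subset> K" by blast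
    obtain f where f: "\<And>n::nat. f n \<in> C \<and> f n \<subset> f (Suc n)"
      using dependent_nat_choice[of "\<lambda>_ J. J \<in> C" "\<lambda>_ J K. J \<subset> K"] zero step by metis
    then have "\<exists>N. \<forall>n\<ge>N. f n = f N"
      by (intro acc) (auto simp: C_def)
    then show False using f by (metis le_Suc_eq order_refl psubset_eq)
  qed
  then obtain J where J: "J \<in> C" and max: "\<And>K. K \<in> C \<Longrightarrow> \<not> J \<subset> K" by blast
  obtain m where m: "word_nilpotent J m" using J by (auto simp: C_def)
  have Js: "superideal J R" and Ji: "ideal J R" using J by (auto simp: C_def superideal_def)
  note Jc = ideal.Icarr[OF Ji]
  note Jadd = additive_subgroup.a_closed[OF ideal.axioms(1)[OF Ji]]
    and Jzero = additive_subgroup.zero_closed[OF ideal.axioms(1)[OF Ji]]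
  have hom: "x \<in> J" if x: "x \<in> rpart R p" and k: "x [^] (k::nat) = \<zero>" for x p k
  proof -
    let ?L = "J <+> (\<lambda>r. r \<otimes> x) ` carrier R"
    note xc = rpart_carrier[OF x]
    have "?L \<in> C"
      unfolding C_def using superideal_add_principal[OF Js x] word_nilpotent_add_principal[OF Ji m x k] by blast
    moreover have "J \<subseteq> ?L"
    proof
      fix j assume "j \<in> J"
      moreover from this have "j = j \<oplus> \<zero> \<otimes> x" using Jc xc by simp
      ultimately show "j \<in> ?L" by (force simp: set_add_def')
    qed
    moreover have "x \<in> ?L"
    proof -
      have "x = \<zero> \<oplus> \<one> \<otimes> x" using xc by simp
      then show ?thesis using Jzero by (force simp: set_add_def')
    qed
    ultimately show ?thesis using max by blast
  qed
  have "I \<subseteq> J"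
  proof
    fix x assume "x \<in> I"
    then have "x \<in> (I \<inter> rpart R 0) <+> (I \<inter> rpart R 1)"
      using I by (simp add: superideal_def)
    then obtain x0 x1 where xd: "x0 \<in> I" "x0 \<in> rpart R 0" "x1 \<in> rpart R 1" "x = x0 \<oplus> x1"
      by (auto simp: set_add_def')
    have "x1 [^] (2::nat) = \<zero>"
      using odd_square[OF xd(3)] rpart_carrier[OF xd(3)] by (simp add: numeral_2_eq_2)
    then have x1: "x1 \<in> J" using hom xd by blast
    \<comment> \<open>The nilradical only offers some decomposition of \<open>x0\<close> into a
      nilpotent even \<open>a\<close> and an odd \<open>b\<close>. As \<open>x0\<close> and
      \<open>a\<close> are even, \<open>b\<close> has both parities, so it vanishes and
      \<open>x0\<close> itself is nilpotent.\<close>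
    obtain a b k where ab: "a \<in> rpart R 0" "a [^] (k::nat) = \<zero>" "b \<in> rpart R 1" "x0 = a \<oplus> b"
      using xd(1) nil by (auto simp: nilrad_def set_add_def')
    have c: "a \<in> carrier R" "b \<in> carrier R" using ab rpart_carrier by auto
    have b: "b = \<ominus> a \<oplus> x0" using ab c by (simp add: r_neg1)
    have "b \<in> rpart R 0" by (subst b) (intro rpart_add rpart_neg ab xd)
    then have "x0 = a" using ab rpart_disjoint c by simp
    then have "x0 \<in> J" using hom ab by blast
    with x1 xd show "x \<in> J" using Jadd by simp
  qed
  then have "word_nilpotent I m"
    using m unfolding word_nilpotent_def by blast
  then show ?thesis
    using ideal_pow_eq_zero I by (auto simp: superideal_def)
qed

section \<open>Filtered modules and Cauchy products\<close>

text \<open>Module axioms without gradings, over a ring that may be noncommutative: they hold both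
  for a supermodule and for a ring acting on itself.\<close>

locale left_module = R?: ring R + M?: abelian_group M
  for R :: "('a, 'm) ring_scheme" (structure) and M :: "('a, 'b, 'n) module_scheme" (structure) +
  assumes smult_closed: "\<lbrakk> a \<in> carrier R; x \<in> carrier M \<rbrakk> \<Longrightarrow> a \<odot>\<^bsub>M\<^esub> x \<in> carrier M"
    and smult_l_distr: "\<lbrakk> a \<in> carrier R; b \<in> carrier R; x \<in> carrier M \<rbrakk> \<Longrightarrow>
          (a \<oplus>\<^bsub>R\<^esub> b) \<odot>\<^bsub>M\<^esub> x = a \<odot>\<^bsub>M\<^esub> x \<oplus>\<^bsub>M\<^esub> b \<odot>\<^bsub>M\<^esub> x"
    and smult_r_distr: "\<lbrakk> a \<in> carrier R; x \<in> carrier M; y \<in> carrier M \<rbrakk> \<Longrightarrow>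
          a \<odot>\<^bsub>M\<^esub> (x \<oplus>\<^bsub>M\<^esub> y) = a \<odot>\<^bsub>M\<^esub> x \<oplus>\<^bsub>M\<^esub> a \<odot>\<^bsub>M\<^esub> y"
    and smult_assoc: "\<lbrakk> a \<in> carrier R; b \<in> carrier R; x \<in> carrier M \<rbrakk> \<Longrightarrow>
          (a \<otimes>\<^bsub>R\<^esub> b) \<odot>\<^bsub>M\<^esub> x = a \<odot>\<^bsub>M\<^esub> (b \<odot>\<^bsub>M\<^esub> x)"
    and smult_one: "x \<in> carrier M \<Longrightarrow> \<one>\<^bsub>R\<^esub> \<odot>\<^bsub>M\<^esub> x = x"

sublocale super_module \<subseteq> left_module
  by unfold_locales (auto simp: smult_closed smult_l_distr smult_r_distr smult_assoc smult_one)

text \<open>The Cauchy product of two sequences of representatives. Computations with it take place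
  in \<open>M\<close> itself, where the algebraic laws hold exactly and not merely modulo the
  filtration.\<close>

definition conv :: "('a, 'b, 'n) module_scheme \<Rightarrow> (nat \<Rightarrow> 'a) \<Rightarrow> (nat \<Rightarrow> 'b) \<Rightarrow> nat \<Rightarrow> 'b" where
  "conv M y x n = (\<Oplus>\<^bsub>M\<^esub>i\<in>{..n}. y i \<odot>\<^bsub>M\<^esub> x (n - i))"

text \<open>A ring as a left module over itself: the multiplication of the associated graded ring is then
  the scalar multiplication of an associated graded module.\<close>

definition regular :: "('a, 'm) ring_scheme \<Rightarrow> ('a, 'a) module" where
  "regular R = \<lparr>carrier = carrier R, mult = mult R, one = one R, zero = zero R, add = add R,
     smult = mult R\<rparr>"

lemma regular_simps [simp]:
  "carrier (regular R) = carrier R" "zero (regular R) = zero R" "add (regular R) = add R"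
  "smult (regular R) = mult R" "a_r_coset (regular R) = a_r_coset R"
  "set_add (regular R) = set_add R" "finsum (regular R) = finsum R"
  "regular R A_Mod H = R A_Mod H"
  by (auto simp: regular_def a_r_coset_def' set_add_def' fun_eq_iff finsum_def finprod_def
      A_FactGroup_def' A_RCOSETS_def')

lemma rcoset_smult_regular [simp]: "rcoset_smult (regular R) = rcoset_mult R"
  by (simp add: fun_eq_iff rcoset_smult_def rcoset_mult_def)

lemma (in ring) left_module_regular: "left_module R (regular R)"
proof -
  have "abelian_group (regular R)"
  proof (rule abelian_groupI)
    fix x assume "x \<in> carrier (regular R)"
    then show "\<exists>y\<in>carrier (regular R). y \<oplus>\<^bsub>regular R\<^esub> x = \<zero>\<^bsub>regular R\<^esub>"
      by (intro bexI[of _ "\<ominus> x"]) (auto simp: l_neg)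
  qed (auto simp: a_ac)
  then interpret M: abelian_group "regular R" .
  show ?thesis
    by unfold_locales (auto simp: l_distr r_distr m_assoc)
qed

context left_module begin

lemma smult_r_zero: "a \<in> carrier R \<Longrightarrow> a \<odot>\<^bsub>M\<^esub> \<zero>\<^bsub>M\<^esub> = \<zero>\<^bsub>M\<^esub>"
  using smult_r_distr[of a "\<zero>\<^bsub>M\<^esub>" "\<zero>\<^bsub>M\<^esub>"] smult_closed[of a "\<zero>\<^bsub>M\<^esub>"]
    M.add.r_cancel_one'[of "a \<odot>\<^bsub>M\<^esub> \<zero>\<^bsub>M\<^esub>" "a \<odot>\<^bsub>M\<^esub> \<zero>\<^bsub>M\<^esub>"] by simp

lemma smult_l_zero: "x \<in> carrier M \<Longrightarrow> \<zero> \<odot>\<^bsub>M\<^esub> x = \<zero>\<^bsub>M\<^esub>"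
  using smult_l_distr[of "\<zero>" "\<zero>" x] smult_closed[of "\<zero>" x]
    M.add.r_cancel_one'[of "\<zero> \<odot>\<^bsub>M\<^esub> x" "\<zero> \<odot>\<^bsub>M\<^esub> x"] by simp

lemma smult_r_minus:
  assumes "a \<in> carrier R" "x \<in> carrier M"
  shows "a \<odot>\<^bsub>M\<^esub> (\<ominus>\<^bsub>M\<^esub> x) = \<ominus>\<^bsub>M\<^esub> (a \<odot>\<^bsub>M\<^esub> x)"
  using smult_r_distr[of a "\<ominus>\<^bsub>M\<^esub> x" x] assms
    M.minus_equality[of "a \<odot>\<^bsub>M\<^esub> (\<ominus>\<^bsub>M\<^esub> x)" "a \<odot>\<^bsub>M\<^esub> x"]
  by (simp add: smult_closed smult_r_zero M.l_neg)

lemma smult_finsum: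
  "finite A \<Longrightarrow> a \<in> carrier R \<Longrightarrow> f \<in> A \<rightarrow> carrier M \<Longrightarrow>
    a \<odot>\<^bsub>M\<^esub> (\<Oplus>\<^bsub>M\<^esub>i\<in>A. f i) = (\<Oplus>\<^bsub>M\<^esub>i\<in>A. a \<odot>\<^bsub>M\<^esub> f i)"
  by (induction A rule: finite_induct) (auto simp: smult_r_zero smult_r_distr smult_closed Pi_def)

lemma conv_add_left:
  assumes "\<And>n. y n \<in> carrier R" "\<And>n. z n \<in> carrier R" "\<And>n. x n \<in> carrier M"
  shows "conv M (\<lambda>n. y n \<oplus> z n) x n = conv M y x n \<oplus>\<^bsub>M\<^esub> conv M z x n"
  unfolding conv_def using assms
  by (simp add: smult_l_distr M.finsum_addf smult_closed)

lemma conv_add_right: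
  assumes "\<And>n. y n \<in> carrier R" "\<And>n. x n \<in> carrier M" "\<And>n. w n \<in> carrier M"
  shows "conv M y (\<lambda>n. x n \<oplus>\<^bsub>M\<^esub> w n) n = conv M y x n \<oplus>\<^bsub>M\<^esub> conv M y w n"
  unfolding conv_def using assms
  by (simp add: smult_r_distr M.finsum_addf smult_closed)

lemma finsum_delta:
  assumes "finite A" "i \<in> A" "\<And>j. j \<in> A \<Longrightarrow> f j \<in> carrier M" "\<And>j. j \<in> A \<Longrightarrow> j \<noteq> i \<Longrightarrow> f j = \<zero>\<^bsub>M\<^esub>"
  shows "(\<Oplus>\<^bsub>M\<^esub>j\<in>A. f j) = f i"
proof -
  have "(\<Oplus>\<^bsub>M\<^esub>j\<in>A. f j) = (\<Oplus>\<^bsub>M\<^esub>j\<in>A. if i = j then f j else \<zero>\<^bsub>M\<^esub>)"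
    using assms by (intro M.finsum_cong') auto
  also have "\<dots> = f i"
    using assms by (intro M.finsum_singleton) auto
  finally show ?thesis .
qed

lemma conv_const:
  assumes "a \<in> carrier R" "\<And>n. x n \<in> carrier M"
  shows "conv M (\<lambda>n. if n = 0 then a else \<zero>) x n = a \<odot>\<^bsub>M\<^esub> x n"
  unfolding conv_def using assms
  by (subst finsum_delta[where i = 0]) (auto simp: smult_closed smult_l_zero)

lemma conv_concentrated:
  assumes "\<And>n. y n \<in> carrier R" "x \<in> carrier M"
  shows "conv M y (\<lambda>n. if n = k then x else \<zero>\<^bsub>M\<^esub>) k = y 0 \<odot>\<^bsub>M\<^esub> x"
  unfolding conv_def using assms
  by (subst finsum_delta[where i = 0]) (auto simp: smult_closed smult_r_zero)

lemma conv_assoc: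
  assumes y: "\<And>n. y n \<in> carrier R" and z: "\<And>n. z n \<in> carrier R" and x: "\<And>n. x n \<in> carrier M"
  shows "conv M (conv (regular R) y z) x n = conv M y (conv M z x) n"
proof -
  \<comment> \<open>Both sides collect the terms of total ring degree at most \<open>k\<close>,
    while \<open>n\<close> stays fixed. The induction step adds the terms of ring degree
    \<open>k + 1\<close>; the case \<open>k = n\<close> is associativity.\<close>
  have "k \<le> n \<Longrightarrow> (\<Oplus>\<^bsub>M\<^esub>j\<in>{..k}. (\<Oplus>i\<in>{..j}. y i \<otimes> z (j - i)) \<odot>\<^bsub>M\<^esub> x (n - j)) =
      (\<Oplus>\<^bsub>M\<^esub>j\<in>{..k}. y j \<odot>\<^bsub>M\<^esub> (\<Oplus>\<^bsub>M\<^esub>i\<in>{..k - j}. z i \<odot>\<^bsub>M\<^esub> x (n - j - i)))" for k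
  proof (induction k)
    case 0
    then show ?case using assms by (simp add: Pi_def smult_assoc smult_closed)
  next
    case (Suc k)
    have l: "(\<Oplus>i\<in>{..j}. y i \<otimes> z (j - i)) \<in> carrier R" for j
      using assms by (intro R.finsum_closed) auto
    have r: "(\<Oplus>\<^bsub>M\<^esub>i\<in>{..m}. z i \<odot>\<^bsub>M\<^esub> x (n - j - i)) \<in> carrier M" for j m
      using assms by (intro M.finsum_closed) (auto simp: smult_closed)
    have swap: "(\<Oplus>i\<in>A. f i) \<odot>\<^bsub>M\<^esub> v = (\<Oplus>\<^bsub>M\<^esub>i\<in>A. f i \<odot>\<^bsub>M\<^esub> v)"
      if "finite A" "\<And>i. f i \<in> carrier R" "v \<in> carrier M" for A :: "nat set" and f v
      using that(1) by (induction rule: finite_induct)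
        (auto simp: smult_l_zero smult_l_distr smult_closed that Pi_def)
    have "(\<Oplus>\<^bsub>M\<^esub>j\<in>{..Suc k}. y j \<odot>\<^bsub>M\<^esub> (\<Oplus>\<^bsub>M\<^esub>i\<in>{..Suc k - j}. z i \<odot>\<^bsub>M\<^esub> x (n - j - i)))
      = y (Suc k) \<odot>\<^bsub>M\<^esub> (z 0 \<odot>\<^bsub>M\<^esub> x (n - Suc k)) \<oplus>\<^bsub>M\<^esub>
        (\<Oplus>\<^bsub>M\<^esub>j\<in>{..k}. y j \<odot>\<^bsub>M\<^esub> (\<Oplus>\<^bsub>M\<^esub>i\<in>{..Suc k - j}. z i \<odot>\<^bsub>M\<^esub> x (n - j - i)))"
      using assms r by (subst M.finsum_Suc) (auto simp: smult_closed)
    also have "(\<Oplus>\<^bsub>M\<^esub>j\<in>{..k}. y j \<odot>\<^bsub>M\<^esub> (\<Oplus>\<^bsub>M\<^esub>i\<in>{..Suc k - j}. z i \<odot>\<^bsub>M\<^esub> x (n - j - i)))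
      = (\<Oplus>\<^bsub>M\<^esub>j\<in>{..k}. y j \<odot>\<^bsub>M\<^esub> (z (Suc k - j) \<odot>\<^bsub>M\<^esub> x (n - Suc k)) \<oplus>\<^bsub>M\<^esub>
          y j \<odot>\<^bsub>M\<^esub> (\<Oplus>\<^bsub>M\<^esub>i\<in>{..k - j}. z i \<odot>\<^bsub>M\<^esub> x (n - j - i)))"
    proof (rule M.finsum_cong')
      fix j assume "j \<in> {..k}"
      then have "Suc k - j = Suc (k - j)" "n - j - Suc (k - j) = n - Suc k" by auto
      then show "y j \<odot>\<^bsub>M\<^esub> (\<Oplus>\<^bsub>M\<^esub>i\<in>{..Suc k - j}. z i \<odot>\<^bsub>M\<^esub> x (n - j - i)) =
        y j \<odot>\<^bsub>M\<^esub> (z (Suc k - j) \<odot>\<^bsub>M\<^esub> x (n - Suc k)) \<oplus>\<^bsub>M\<^esub>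
          y j \<odot>\<^bsub>M\<^esub> (\<Oplus>\<^bsub>M\<^esub>i\<in>{..k - j}. z i \<odot>\<^bsub>M\<^esub> x (n - j - i))"
        using assms r by (simp add: smult_closed smult_r_distr)
    qed (use assms r in \<open>auto simp: smult_closed\<close>)
    also have "\<dots> = (\<Oplus>\<^bsub>M\<^esub>j\<in>{..k}. y j \<odot>\<^bsub>M\<^esub> (z (Suc k - j) \<odot>\<^bsub>M\<^esub> x (n - Suc k))) \<oplus>\<^bsub>M\<^esub>
        (\<Oplus>\<^bsub>M\<^esub>j\<in>{..k}. y j \<odot>\<^bsub>M\<^esub> (\<Oplus>\<^bsub>M\<^esub>i\<in>{..k - j}. z i \<odot>\<^bsub>M\<^esub> x (n - j - i)))"
      using assms r by (intro M.finsum_addf) (auto simp: smult_closed)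
    also have "(\<Oplus>\<^bsub>M\<^esub>j\<in>{..k}. y j \<odot>\<^bsub>M\<^esub> (\<Oplus>\<^bsub>M\<^esub>i\<in>{..k - j}. z i \<odot>\<^bsub>M\<^esub> x (n - j - i)))
      = (\<Oplus>\<^bsub>M\<^esub>j\<in>{..k}. (\<Oplus>i\<in>{..j}. y i \<otimes> z (j - i)) \<odot>\<^bsub>M\<^esub> x (n - j))"
      using Suc by simp
    finally have rhs: "(\<Oplus>\<^bsub>M\<^esub>j\<in>{..Suc k}. y j \<odot>\<^bsub>M\<^esub> (\<Oplus>\<^bsub>M\<^esub>i\<in>{..Suc k - j}. z i \<odot>\<^bsub>M\<^esub> x (n - j - i)))
      = y (Suc k) \<odot>\<^bsub>M\<^esub> (z 0 \<odot>\<^bsub>M\<^esub> x (n - Suc k)) \<oplus>\<^bsub>M\<^esub>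
        ((\<Oplus>\<^bsub>M\<^esub>j\<in>{..k}. y j \<odot>\<^bsub>M\<^esub> (z (Suc k - j) \<odot>\<^bsub>M\<^esub> x (n - Suc k))) \<oplus>\<^bsub>M\<^esub>
        (\<Oplus>\<^bsub>M\<^esub>j\<in>{..k}. (\<Oplus>i\<in>{..j}. y i \<otimes> z (j - i)) \<odot>\<^bsub>M\<^esub> x (n - j)))" .
    have "(\<Oplus>\<^bsub>M\<^esub>j\<in>{..Suc k}. (\<Oplus>i\<in>{..j}. y i \<otimes> z (j - i)) \<odot>\<^bsub>M\<^esub> x (n - j)) =
      (\<Oplus>i\<in>{..Suc k}. y i \<otimes> z (Suc k - i)) \<odot>\<^bsub>M\<^esub> x (n - Suc k) \<oplus>\<^bsub>M\<^esub>
      (\<Oplus>\<^bsub>M\<^esub>j\<in>{..k}. (\<Oplus>i\<in>{..j}. y i \<otimes> z (j - i)) \<odot>\<^bsub>M\<^esub> x (n - j))"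
      using x l by (subst M.finsum_Suc) (auto simp: smult_closed)
    also have "(\<Oplus>i\<in>{..Suc k}. y i \<otimes> z (Suc k - i)) \<odot>\<^bsub>M\<^esub> x (n - Suc k) =
      (\<Oplus>\<^bsub>M\<^esub>i\<in>{..Suc k}. y i \<odot>\<^bsub>M\<^esub> (z (Suc k - i) \<odot>\<^bsub>M\<^esub> x (n - Suc k)))"
      using assms by (simp only: swap finite_atMost R.m_closed smult_assoc)
    also have "\<dots> = y (Suc k) \<odot>\<^bsub>M\<^esub> (z 0 \<odot>\<^bsub>M\<^esub> x (n - Suc k)) \<oplus>\<^bsub>M\<^esub>
      (\<Oplus>\<^bsub>M\<^esub>i\<in>{..k}. y i \<odot>\<^bsub>M\<^esub> (z (Suc k - i) \<odot>\<^bsub>M\<^esub> x (n - Suc k)))"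
      using assms by (subst M.finsum_Suc) (auto simp: smult_closed)
    finally show ?case
      unfolding rhs using assms l by (simp add: M.a_assoc smult_closed)
  qed
  from this[of n] show ?thesis
    unfolding conv_def by (simp add: diff_diff_left)
qed

end

lemma (in abelian_subgroup) finprod_a_rcos:
  assumes "finite A" "f \<in> A \<rightarrow> carrier G"
  shows "finprod (G A_Mod H) (\<lambda>i. H +> f i) A = H +> (\<Oplus>i\<in>A. f i)"
proof -
  interpret Q: Group.comm_monoid "G A_Mod H"
    using a_factorgroup_is_comm_group by (rule comm_group.axioms)
  have carr: "H +> x \<in> carrier (G A_Mod H)" if "x \<in> carrier G" for x
    using that by (auto simp: A_FactGroup_def' A_RCOSETS_def')
  show ?thesis
    using assms
  proof (induction A rule: finite_induct)
    case empty
    then show ?case using a_subset by (subst Q.finprod_empty) (simp add: A_FactGroup_def')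
  next
    case (insert a A)
    then have "finprod (G A_Mod H) (\<lambda>i. H +> f i) (insert a A) = (H +> f a) <+> (H +> (\<Oplus>i\<in>A. f i))"
      by (subst Q.finprod_insert) (auto simp: carr Pi_def)
    then show ?case
      using insert by (subst finsum_insert) (auto simp: a_rcos_sum)
  qed
qed

section \<open>Filtrations by powers of a nilpotent ideal\<close>

locale nilpotent_ideal = ring R + ideal I R
  for R :: "('a, 'm) ring_scheme" (structure) and I :: "'a set" +
  fixes N :: nat
  assumes nilpotent: "ideal_pow R I N = {\<zero>}"
begin

lemma ideal_pow_ideal: "ideal (ideal_pow R I n) R"
  by (induction n) (auto simp: oneideal intro!: ideal_prod_is_ideal is_ideal)

lemma ideal_pow_carrier: "y \<in> ideal_pow R I n \<Longrightarrow> y \<in> carrier R"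
  using ideal.Icarr[OF ideal_pow_ideal] .

lemmas ideal_pow_zero = additive_subgroup.zero_closed[OF ideal.axioms(1)[OF ideal_pow_ideal]]
  and ideal_pow_a_closed = additive_subgroup.a_closed[OF ideal.axioms(1)[OF ideal_pow_ideal]]

lemma ideal_pow_Suc_subset: "ideal_pow R I (Suc n) \<subseteq> ideal_pow R I n"
  using ideal_prod_inter[OF is_ideal ideal_pow_ideal] by simp

lemma ideal_pow_eq_0: "n \<ge> N \<Longrightarrow> ideal_pow R I n = {\<zero>}"
proof (induction n rule: dec_induct)
  case (step n)
  then show ?case using ideal_pow_Suc_subset[of n] ideal_pow_zero[of "Suc n"] by auto
qed (rule nilpotent)

text \<open>Powers grow by factors of \<open>I\<close> on the left, so the induction runs over the
  exponent of the left factor.\<close>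

lemma ideal_pow_mult:
  "y \<in> ideal_pow R I a \<Longrightarrow> z \<in> ideal_pow R I b \<Longrightarrow> y \<otimes> z \<in> ideal_pow R I (a + b)"
proof (induction a arbitrary: y)
  case 0
  then show ?case by (simp add: ideal.I_l_closed[OF ideal_pow_ideal])
next
  case (Suc a)
  from Suc.prems(1) have "y \<in> ideal_prod R I (ideal_pow R I a)" by simp
  then show ?case
  proof induction
    case (prod i j)
    then have "(i \<otimes> j) \<otimes> z = i \<otimes> (j \<otimes> z)"
      using Suc.prems(2) ideal_pow_carrier Icarr by (simp add: m_assoc)
    then show ?case
      using Suc.IH[OF prod(2) Suc.prems(2)] prod(1) by (simp add: ideal_prod.prod)
  next
    case (sum s t)
    then have "s \<in> carrier R" "t \<in> carrier R"
      using ideal_pow_carrier[of _ "Suc a"] by auto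
    then show ?case
      using sum Suc.prems(2) ideal_pow_carrier ideal_pow_a_closed[of _ "Suc a + b"] by (simp add: l_distr)
  qed
qed

end

text \<open>Defined for all sequences. Those with \<open>x n\<close> in \<open>F n\<close> represent
  elements of the graded object, and only a comparison of two classes has to return to
  cosets.\<close>

definition gr_class :: "('b, 'm) ring_scheme \<Rightarrow> (nat \<Rightarrow> 'b set) \<Rightarrow> (nat \<Rightarrow> 'b) \<Rightarrow> nat \<Rightarrow> 'b set" where
  "gr_class G F x = (\<lambda>n. F (Suc n) +>\<^bsub>G\<^esub> x n)"

text \<open>One notion for the powers of \<open>I\<close> in the ring and for the subgroups
  \<open>I^n M\<close> of the module; \<open>F_zero\<close> records the nilpotency of
  \<open>I\<close>.\<close>

locale nilpotent_filtration = abelian_group G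
  for G :: "('b, 'm) ring_scheme" (structure) and F :: "nat \<Rightarrow> 'b set" and N :: nat +
  assumes F_subgroup: "additive_subgroup (F n) G"
    and F_decreasing: "F (Suc n) \<subseteq> F n"
    and F_zero: "n \<ge> N \<Longrightarrow> F n = {\<zero>}"
begin

lemma F_abelian_subgroup: "abelian_subgroup (F n) G"
  by (rule abelian_subgroupI3[OF F_subgroup abelian_group_axioms])

lemma F_carrier: "x \<in> F n \<Longrightarrow> x \<in> carrier G"
  by (rule additive_subgroup.a_Hcarr[OF F_subgroup])

lemmas F_a_closed = additive_subgroup.a_closed[OF F_subgroup]
  and F_zero_closed = additive_subgroup.zero_closed[OF F_subgroup]
  and F_a_inv_closed = additive_subgroup.a_inv_closed[OF F_subgroup]

lemma coset_eq_iff: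
  assumes "x \<in> carrier G" "y \<in> carrier G"
  shows "F n +> x = F n +> y \<longleftrightarrow> x \<oplus> \<ominus> y \<in> F n"
  using abelian_subgroup.a_rcos_module[OF F_abelian_subgroup assms(2,1)]
    abelian_subgroup.a_repr_independence'[OF F_abelian_subgroup _ assms(2)]
    abelian_subgroup.a_repr_independenceD[OF F_abelian_subgroup assms(1)] by metis

lemma coset_zero: "F n +> \<zero> = F n"
  using F_carrier by (intro a_coset_add_zero) auto

lemma coset_eq_zero_iff: "x \<in> carrier G \<Longrightarrow> F n +> x = F n \<longleftrightarrow> x \<in> F n"
  using coset_eq_iff[of x \<zero> n] coset_zero minus_equality[of \<zero> \<zero>] by simp

lemma gr_class_eq_iff:
  assumes "\<And>n. x n \<in> carrier G" "\<And>n. y n \<in> carrier G"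
  shows "gr_class G F x = gr_class G F y \<longleftrightarrow> (\<forall>n. x n \<oplus> \<ominus> y n \<in> F (Suc n))"
  using assms by (simp add: gr_class_def fun_eq_iff coset_eq_iff)

lemma gr_class_add:
  assumes "\<And>n. x n \<in> carrier G" "\<And>n. y n \<in> carrier G"
  shows "(\<lambda>n. set_add G (gr_class G F x n) (gr_class G F y n)) = gr_class G F (\<lambda>n. x n \<oplus> y n)"
  using assms by (simp add: gr_class_def abelian_subgroup.a_rcos_sum[OF F_abelian_subgroup])

lemma gr_class_zero: "gr_class G F (\<lambda>n. \<zero>) = (\<lambda>n. F (Suc n))"
  by (simp add: gr_class_def coset_zero)

text \<open>The support is finite because the filtration is eventually zero.\<close>

lemma gr_part_eq:
  "gr_part G P F p = gr_class G F ` {x. \<forall>n. x n \<in> F n \<inter> P p}"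
proof
  show "gr_part G P F p \<subseteq> gr_class G F ` {x. \<forall>n. x n \<in> F n \<inter> P p}"
  proof
    fix f assume "f \<in> gr_part G P F p"
    then have "\<forall>n. \<exists>x. x \<in> F n \<inter> P p \<and> f n = F (Suc n) +> x"
      by (auto simp: gr_part_def)
    then obtain x where "\<forall>n. x n \<in> F n \<inter> P p \<and> f n = F (Suc n) +> x n" by metis
    then show "f \<in> gr_class G F ` {x. \<forall>n. x n \<in> F n \<inter> P p}"
      by (intro image_eqI[of _ _ x]) (auto simp: gr_class_def)
  qed
  have "finite {n. gr_class G F x n \<noteq> F (Suc n)}" if "\<And>n. x n \<in> F n" for x
  proof (rule finite_subset)
    show "{n. gr_class G F x n \<noteq> F (Suc n)} \<subseteq> {..<N}"
    proof (intro subsetI CollectI, rule ccontr)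
      fix n assume n: "n \<in> {n. gr_class G F x n \<noteq> F (Suc n)}" "n \<notin> {..<N}"
      then have "x n = \<zero>" using that[of n] F_zero[of n] by simp
      with n show False by (simp add: gr_class_def coset_zero)
    qed
  qed simp
  then show "gr_class G F ` {x. \<forall>n. x n \<in> F n \<inter> P p} \<subseteq> gr_part G P F p"
    by (auto simp: gr_part_def gr_carrier_def) (auto simp: gr_class_def)
qed

text \<open>The carrier is the part belonging to the trivial grading
  \<open>\<lambda>_. UNIV\<close>, so the argument about representatives and supports is made only
  once.\<close>

lemma gr_carrier_eq: "gr_carrier G F = gr_class G F ` {x. \<forall>n. x n \<in> F n}"
  using gr_part_eq[of "\<lambda>_. UNIV" 0] by (auto simp: gr_part_def gr_carrier_def)

end

locale filtered_module = left_module R M + nilpotent_ideal R I N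
  for R :: "('a, 'm) ring_scheme" (structure) and M :: "('a, 'b, 'n) module_scheme" (structure)
    and I :: "'a set" and N :: nat
begin

lemma pow_smult_subgroup: "additive_subgroup (pow_smult R I M n) M"
  unfolding pow_smult_def ideal_smult_def
  by (intro additive_subgroup.intro M.add.generate_is_subgroup) (auto simp: smult_closed ideal_pow_carrier)

lemma pow_smult_gen: "a \<in> ideal_pow R I n \<Longrightarrow> x \<in> carrier M \<Longrightarrow> a \<odot>\<^bsub>M\<^esub> x \<in> pow_smult R I M n"
  unfolding pow_smult_def ideal_smult_def by (rule generate.incl) auto

lemma pow_smult_subset:
  assumes "additive_subgroup H M" "\<And>a x. a \<in> ideal_pow R I n \<Longrightarrow> x \<in> carrier M \<Longrightarrow> a \<odot>\<^bsub>M\<^esub> x \<in> H"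
  shows "pow_smult R I M n \<subseteq> H"
  unfolding pow_smult_def ideal_smult_def
  using assms by (intro M.add.generate_subgroup_incl) (auto simp: additive_subgroup_def)

lemma nilpotent_filtration: "nilpotent_filtration M (pow_smult R I M) N"
proof (intro nilpotent_filtration.intro nilpotent_filtration_axioms.intro)
  show "abelian_group M" ..
  fix n
  show "additive_subgroup (pow_smult R I M n) M" by (rule pow_smult_subgroup)
  show "pow_smult R I M (Suc n) \<subseteq> pow_smult R I M n"
    using ideal_pow_Suc_subset pow_smult_gen by (intro pow_smult_subset pow_smult_subgroup) blast
  show "pow_smult R I M n = {\<zero>\<^bsub>M\<^esub>}" if "n \<ge> N"
  proof
    have "additive_subgroup {\<zero>\<^bsub>M\<^esub>} M"
      by (intro additive_subgroup.intro M.add.subgroupI) auto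
    then show "pow_smult R I M n \<subseteq> {\<zero>\<^bsub>M\<^esub>}"
      by (rule pow_smult_subset) (simp add: ideal_pow_eq_0[OF that] smult_l_zero)
    show "{\<zero>\<^bsub>M\<^esub>} \<subseteq> pow_smult R I M n"
      using additive_subgroup.zero_closed[OF pow_smult_subgroup] by simp
  qed
qed

sublocale F: nilpotent_filtration M "pow_smult R I M" N
  by (rule nilpotent_filtration)

text \<open>The elements that \<open>y\<close> sends into \<open>I^(a+b) M\<close> form a subgroup,
  so it suffices to test generators of \<open>I^b M\<close>; there \<open>y\<close> is absorbed into
  the coefficient.\<close>

lemma smult_pow_smult:
  assumes y: "y \<in> ideal_pow R I a" and x: "x \<in> pow_smult R I M b"
  shows "y \<odot>\<^bsub>M\<^esub> x \<in> pow_smult R I M (a + b)"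
proof -
  let ?H = "{x \<in> carrier M. y \<odot>\<^bsub>M\<^esub> x \<in> pow_smult R I M (a + b)}"
  note yc = ideal_pow_carrier[OF y]
  have "additive_subgroup ?H M"
  proof (intro additive_subgroup.intro M.add.subgroupI)
    show "?H \<noteq> {}"
      using smult_r_zero[OF yc] F.F_zero_closed by force
  qed (auto simp: smult_r_minus smult_r_distr yc F.F_a_closed F.F_a_inv_closed)
  then have "pow_smult R I M b \<subseteq> ?H"
  proof (rule pow_smult_subset)
    fix c v assume c: "c \<in> ideal_pow R I b" "v \<in> carrier M"
    then have "y \<odot>\<^bsub>M\<^esub> (c \<odot>\<^bsub>M\<^esub> v) = (y \<otimes> c) \<odot>\<^bsub>M\<^esub> v"
      using ideal_pow_carrier yc by (simp add: smult_assoc)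
    then show "c \<odot>\<^bsub>M\<^esub> v \<in> ?H"
      using pow_smult_gen[OF ideal_pow_mult[OF y c(1)] c(2)] c ideal_pow_carrier
      by (simp add: smult_closed)
  qed
  with x show ?thesis by blast
qed

lemma conv_pow_smult:
  assumes "\<And>n. y n \<in> ideal_pow R I n" "\<And>n. x n \<in> pow_smult R I M n"
  shows "conv M y x n \<in> pow_smult R I M n"
proof -
  have c: "y i \<odot>\<^bsub>M\<^esub> x j \<in> carrier M" for i j
    using assms ideal_pow_carrier F.F_carrier by (meson smult_closed)
  have "(\<Oplus>\<^bsub>M\<^esub>i\<in>A. y i \<odot>\<^bsub>M\<^esub> x (n - i)) \<in> pow_smult R I M n" if "finite A" "A \<subseteq> {..n}" for A
    using that
  proof (induction A rule: finite_induct)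
    case (insert i A)
    moreover have "y i \<odot>\<^bsub>M\<^esub> x (n - i) \<in> pow_smult R I M n"
      using smult_pow_smult[OF assms(1)[of i] assms(2)[of "n - i"]] insert.prems by simp
    ultimately show ?case
      by (simp add: c F.F_a_closed)
  qed (simp add: F.F_zero_closed)
  then show ?thesis unfolding conv_def by blast
qed

text \<open>Independence of representatives. Changing \<open>y\<close> by \<open>u\<close> and
  \<open>x\<close> by \<open>v\<close> changes the product by \<open>u(v + x) + yv\<close>, and each
  summand gains one step of the filtration, from \<open>u\<close> or from \<open>v\<close>.\<close>

lemma rcoset_smult_eq:
  assumes y: "y \<in> ideal_pow R I a" and x: "x \<in> pow_smult R I M b"
  shows "rcoset_smult M (pow_smult R I M (Suc (a + b)))
      (ideal_pow R I (Suc a) +> y) (pow_smult R I M (Suc b) +>\<^bsub>M\<^esub> x) =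
    pow_smult R I M (Suc (a + b)) +>\<^bsub>M\<^esub> (y \<odot>\<^bsub>M\<^esub> x)"
proof -
  let ?H = "pow_smult R I M (Suc (a + b))"
  note yc = ideal_pow_carrier[OF y] and xc = F.F_carrier[OF x]
  have eq: "?H +>\<^bsub>M\<^esub> ((u \<oplus> y) \<odot>\<^bsub>M\<^esub> (v \<oplus>\<^bsub>M\<^esub> x)) = ?H +>\<^bsub>M\<^esub> (y \<odot>\<^bsub>M\<^esub> x)"
    if u: "u \<in> ideal_pow R I (Suc a)" and v: "v \<in> pow_smult R I M (Suc b)" for u v
  proof -
    note uc = ideal_pow_carrier[OF u] and vc = F.F_carrier[OF v]
    let ?w = "u \<odot>\<^bsub>M\<^esub> (v \<oplus>\<^bsub>M\<^esub> x) \<oplus>\<^bsub>M\<^esub> y \<odot>\<^bsub>M\<^esub> v"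
    have e: "(u \<oplus> y) \<odot>\<^bsub>M\<^esub> (v \<oplus>\<^bsub>M\<^esub> x) = ?w \<oplus>\<^bsub>M\<^esub> y \<odot>\<^bsub>M\<^esub> x"
      using uc vc yc xc by (simp add: smult_l_distr smult_r_distr smult_closed M.a_ac)
    have "v \<oplus>\<^bsub>M\<^esub> x \<in> pow_smult R I M b"
      using v x F.F_decreasing F.F_a_closed by blast
    from smult_pow_smult[OF u this] smult_pow_smult[OF y v] have w: "?w \<in> ?H"
      using F.F_a_closed by simp
    then have "?w \<in> carrier M" by (rule F.F_carrier)
    then have "?w \<oplus>\<^bsub>M\<^esub> y \<odot>\<^bsub>M\<^esub> x \<oplus>\<^bsub>M\<^esub> \<ominus>\<^bsub>M\<^esub> (y \<odot>\<^bsub>M\<^esub> x) = ?w"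
      using yc xc by (simp add: M.a_assoc smult_closed M.r_neg)
    with w show ?thesis
      using uc vc yc xc unfolding e by (subst F.coset_eq_iff) (auto simp: smult_closed)
  qed
  show ?thesis
  proof
    show "rcoset_smult M ?H (ideal_pow R I (Suc a) +> y) (pow_smult R I M (Suc b) +>\<^bsub>M\<^esub> x)
        \<subseteq> ?H +>\<^bsub>M\<^esub> (y \<odot>\<^bsub>M\<^esub> x)"
      using eq by (auto simp: rcoset_smult_def a_r_coset_def'[of R] a_r_coset_def'[of M "pow_smult R I M (Suc b)"])
    have "y \<in> ideal_pow R I (Suc a) +> y"
      using abelian_subgroup.a_rcos_self[OF abelian_subgroupI3[OF ideal.axioms(1)[OF ideal_pow_ideal] R.abelian_group_axioms] yc] .
    moreover have "x \<in> pow_smult R I M (Suc b) +>\<^bsub>M\<^esub> x"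
      using abelian_subgroup.a_rcos_self[OF F.F_abelian_subgroup xc] .
    ultimately show "?H +>\<^bsub>M\<^esub> (y \<odot>\<^bsub>M\<^esub> x) \<subseteq>
        rcoset_smult M ?H (ideal_pow R I (Suc a) +> y) (pow_smult R I M (Suc b) +>\<^bsub>M\<^esub> x)"
      unfolding rcoset_smult_def by blast
  qed
qed

text \<open>In degree \<open>n\<close> only factors with degrees adding up to \<open>n\<close> meet,
  so \<open>rcoset_smult_eq\<close> applies to every term and the projection can be taken out of the
  sum.\<close>

lemma gr_smult_class:
  assumes y: "\<And>n. y n \<in> ideal_pow R I n" and x: "\<And>n. x n \<in> pow_smult R I M n"
  shows "(\<lambda>n. finprod (M A_Mod pow_smult R I M (Suc n))
      (\<lambda>i. rcoset_smult M (pow_smult R I M (Suc n)) (gr_class R (ideal_pow R I) y i)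
        (gr_class M (pow_smult R I M) x (n - i))) {..n}) =
    gr_class M (pow_smult R I M) (conv M y x)"
proof
  fix n
  let ?H = "pow_smult R I M (Suc n)"
  have c: "y i \<odot>\<^bsub>M\<^esub> x j \<in> carrier M" for i j
    using assms ideal_pow_carrier F.F_carrier by (meson smult_closed)
  interpret Q: Group.comm_monoid "M A_Mod ?H"
    using abelian_subgroup.a_factorgroup_is_comm_group[OF F.F_abelian_subgroup] by (rule comm_group.axioms)
  have "finprod (M A_Mod ?H) (\<lambda>i. rcoset_smult M ?H (gr_class R (ideal_pow R I) y i)
        (gr_class M (pow_smult R I M) x (n - i))) {..n} =
      finprod (M A_Mod ?H) (\<lambda>i. ?H +>\<^bsub>M\<^esub> (y i \<odot>\<^bsub>M\<^esub> x (n - i))) {..n}"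
  proof (rule Q.finprod_cong')
    show "rcoset_smult M ?H (gr_class R (ideal_pow R I) y i) (gr_class M (pow_smult R I M) x (n - i)) =
      ?H +>\<^bsub>M\<^esub> (y i \<odot>\<^bsub>M\<^esub> x (n - i))" if "i \<in> {..n}" for i
      using rcoset_smult_eq[OF y[of i] x[of "n - i"]] that by (simp add: gr_class_def)
  qed (use c in \<open>force simp: A_FactGroup_def' A_RCOSETS_def'\<close>)+
  also have "\<dots> = gr_class M (pow_smult R I M) (conv M y x) n"
    by (subst abelian_subgroup.finprod_a_rcos[OF F.F_abelian_subgroup])
      (auto simp: c gr_class_def conv_def)
  finally show "finprod (M A_Mod ?H) (\<lambda>i. rcoset_smult M ?H (gr_class R (ideal_pow R I) y i)
        (gr_class M (pow_smult R I M) x (n - i))) {..n} = gr_class M (pow_smult R I M) (conv M y x) n" .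
qed

end

lemma (in nilpotent_ideal) filtered_module_regular: "filtered_module R (regular R) I N"
  using left_module_regular nilpotent_ideal_axioms by (rule filtered_module.intro)

text \<open>With the two filtrations identified, results on graded modules specialise to the
  multiplication of the graded ring.\<close>

lemma (in nilpotent_ideal) pow_smult_regular: "pow_smult R I (regular R) = ideal_pow R I"
proof
  fix n
  interpret reg: filtered_module R "regular R" I N
    by (rule filtered_module_regular)
  have "subgroup (ideal_pow R I n) (add_monoid (regular R))"
  proof (rule reg.M.add.subgroupI)
    \<comment> \<open>Negation in \<open>regular R\<close> refers to the additive monoid of that
      record; uniqueness of inverses identifies it with negation in \<open>R\<close>.\<close>
    have "a_inv (regular R) a = \<ominus> a" if "a \<in> carrier R" for a
      using reg.M.minus_equality[of "\<ominus> a" a] that by (simp add: l_neg)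
    then show "a_inv (regular R) a \<in> ideal_pow R I n" if "a \<in> ideal_pow R I n" for a
      using that ideal_pow_carrier[OF that] additive_subgroup.a_inv_closed[OF ideal.axioms(1)[OF ideal_pow_ideal]]
      by simp
    show "ideal_pow R I n \<noteq> {}" using ideal_pow_zero by blast
  qed (use ideal_pow_carrier ideal_pow_a_closed in auto)
  then have "additive_subgroup (ideal_pow R I n) (regular R)"
    by (rule additive_subgroup.intro)
  then have "pow_smult R I (regular R) n \<subseteq> ideal_pow R I n"
    by (rule reg.pow_smult_subset) (auto intro: ideal.I_r_closed[OF ideal_pow_ideal])
  moreover have "a \<in> pow_smult R I (regular R) n" if "a \<in> ideal_pow R I n" for a
    using reg.pow_smult_gen[OF that, of \<one>] ideal_pow_carrier[OF that] by simp
  ultimately show "pow_smult R I (regular R) n = ideal_pow R I n" by blast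
qed

declare ideal_pow.simps(2) [simp del]

section \<open>The associated graded ring and module\<close>

sublocale nilpotent_ideal \<subseteq> RF: nilpotent_filtration R "ideal_pow R I" N
proof (intro nilpotent_filtration.intro nilpotent_filtration_axioms.intro)
  show "abelian_group R" ..
qed (rule ideal.axioms(1)[OF ideal_pow_ideal] ideal_pow_Suc_subset ideal_pow_eq_0, assumption?)+

context nilpotent_ideal begin

abbreviation rcls :: "(nat \<Rightarrow> 'a) \<Rightarrow> nat \<Rightarrow> 'a set" where
  "rcls \<equiv> gr_class R (ideal_pow R I)"

lemma conv_regular_ideal_pow:
  assumes "\<And>n. y n \<in> ideal_pow R I n" "\<And>n. z n \<in> ideal_pow R I n"
  shows "conv (regular R) y z n \<in> ideal_pow R I n"
  using filtered_module.conv_pow_smult[OF filtered_module_regular] assms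
  by (simp add: pow_smult_regular)

lemma finsum_Quot: "finsum (R Quot H) = finprod (R A_Mod H)"
  by (simp add: finsum_def FactRing_def A_FactGroup_def')

end

lemma even_ring_simps [simp]:
  "carrier (even_ring S) = rpart S 0" "mult (even_ring S) = mult S" "one (even_ring S) = one S"
  "zero (even_ring S) = zero S" "add (even_ring S) = add S"
  by (simp_all add: even_ring_def)

locale super_nilpotent_ideal = super_ring R + nilpotent_ideal R I N
  for R :: "('a, 'm) super_ring_scheme" (structure) and I :: "'a set" and N :: nat
begin

lemma gr_ring_mult:
  assumes "\<And>n. y n \<in> ideal_pow R I n" "\<And>n. z n \<in> ideal_pow R I n"
  shows "rcls y \<otimes>\<^bsub>gr_ring R I\<^esub> rcls z = rcls (conv (regular R) y z)"
  using filtered_module.gr_smult_class[OF filtered_module_regular] assms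
  by (simp add: gr_ring_def finsum_Quot pow_smult_regular gr_class_def)

lemma gr_ring_add:
  assumes "\<And>n. y n \<in> ideal_pow R I n" "\<And>n. z n \<in> ideal_pow R I n"
  shows "rcls y \<oplus>\<^bsub>gr_ring R I\<^esub> rcls z = rcls (\<lambda>n. y n \<oplus> z n)"
  using RF.gr_class_add[OF assms[THEN ideal_pow_carrier]] by (simp add: gr_ring_def)

lemma gr_ring_zero: "\<zero>\<^bsub>gr_ring R I\<^esub> = rcls (\<lambda>n. \<zero>)"
  by (simp add: gr_ring_def RF.gr_class_zero)

lemma gr_ring_one: "\<one>\<^bsub>gr_ring R I\<^esub> = rcls (\<lambda>n. if n = 0 then \<one> else \<zero>)"
  by (rule ext) (simp add: gr_ring_def gr_class_def RF.coset_zero)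

lemma gr_ring_rpart: "rpart (gr_ring R I) p = rcls ` {y. \<forall>n. y n \<in> ideal_pow R I n \<inter> rpart R p}"
  by (simp add: gr_ring_def RF.gr_part_eq)

lemma conv_even:
  assumes "\<And>n. y n \<in> rpart R 0" "\<And>n. z n \<in> rpart R 0"
  shows "conv (regular R) y z n \<in> rpart R 0"
proof -
  have "(\<Oplus>i\<in>A. y i \<otimes> z (n - i)) \<in> rpart R 0" if "finite A" for A
    using that
  proof (induction A rule: finite_induct)
    case (insert i A)
    then show ?case
      using rpart_add part_mult[OF assms(1) assms(2)[of "n - i"], of i] assms[THEN rpart_carrier]
      by (simp add: Pi_def)
  qed (simp add: rpart_zero)
  then show ?thesis by (simp add: conv_def)
qed

lemma conv_comm:
  assumes y: "\<And>n. y n \<in> rpart R 0" and z: "\<And>n. z n \<in> rpart R 0"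
  shows "conv (regular R) y z n = conv (regular R) z y n"
proof -
  have img: "(\<lambda>i. n - i) ` {..n} = {..n}"
  proof
    show "{..n} \<subseteq> (\<lambda>i. n - i) ` {..n}"
      by (rule subsetI, rule_tac x = "n - x" in image_eqI) auto
  qed auto
  have inj: "inj_on (\<lambda>i. n - i) {..n}"
    by (auto intro!: inj_onI)
  have "(\<Oplus>i\<in>{..n}. y i \<otimes> z (n - i)) = (\<Oplus>i\<in>{..n}. y (n - i) \<otimes> z (n - (n - i)))"
    using finsum_reindex[OF _ inj, of "\<lambda>i. y i \<otimes> z (n - i)"] y[THEN rpart_carrier] z[THEN rpart_carrier]
    unfolding img by (simp add: Pi_def)
  also have "\<dots> = (\<Oplus>i\<in>{..n}. z i \<otimes> y (n - i))"
    using y[THEN rpart_carrier] z[THEN rpart_carrier] even_comm[OF y] by (intro finsum_cong') auto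
  finally show ?thesis by (simp add: conv_def)
qed

lemma const_ideal_pow:
  "a \<in> rpart R 0 \<Longrightarrow> (if n = 0 then a else \<zero>) \<in> ideal_pow R I n \<inter> rpart R 0"
  using ideal_pow_zero[of n] rpart_carrier rpart_zero by auto

text \<open>Each axiom is the image under \<open>rcls\<close> of an exact identity between
  sequences; commutativity comes from reversing the order of summation, as even elements
  commute.\<close>

lemma gr_even_ring_cring: "cring (even_ring (gr_ring R I))"
proof -
  interpret reg: left_module R "regular R"
    by (rule left_module_regular)
  let ?G = "even_ring (gr_ring R I)"
  define E where "E = {y. \<forall>n. y n \<in> ideal_pow R I n \<inter> rpart R 0}"
  have carr: "carrier ?G = rcls ` E" by (simp add: gr_ring_rpart E_def)
  have E_mem: "y n \<in> ideal_pow R I n" "y n \<in> rpart R 0" "y n \<in> carrier R" if "y \<in> E" for y n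
    using that rpart_carrier by (auto simp: E_def)
  have mult: "rcls y \<otimes>\<^bsub>?G\<^esub> rcls z = rcls (conv (regular R) y z)" "conv (regular R) y z \<in> E"
    if "y \<in> E" "z \<in> E" for y z
    using gr_ring_mult conv_even conv_regular_ideal_pow that by (auto simp: E_def)
  have add: "rcls y \<oplus>\<^bsub>?G\<^esub> rcls z = rcls (\<lambda>n. y n \<oplus> z n)" "(\<lambda>n. y n \<oplus> z n) \<in> E"
    if "y \<in> E" "z \<in> E" for y z
    using gr_ring_add ideal_pow_a_closed rpart_add that by (auto simp: E_def)
  have zero: "\<zero>\<^bsub>?G\<^esub> = rcls (\<lambda>n. \<zero>)" "(\<lambda>n. \<zero>) \<in> E"
    using gr_ring_zero ideal_pow_zero rpart_zero by (auto simp: E_def)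
  have one: "\<one>\<^bsub>?G\<^esub> = rcls (\<lambda>n. if n = 0 then \<one> else \<zero>)" "(\<lambda>n. if n = 0 then \<one> else \<zero>) \<in> E"
    using gr_ring_one const_ideal_pow[OF one_even] by (auto simp: E_def)
  show ?thesis
  proof (rule cringI)
    show "abelian_group ?G"
    proof (rule abelian_groupI)
      fix f g h assume "f \<in> carrier ?G" "g \<in> carrier ?G" "h \<in> carrier ?G"
      then obtain x y z where "x \<in> E" "y \<in> E" "z \<in> E" "f = rcls x" "g = rcls y" "h = rcls z"
        unfolding carr by blast
      then show "f \<oplus>\<^bsub>?G\<^esub> g \<oplus>\<^bsub>?G\<^esub> h = f \<oplus>\<^bsub>?G\<^esub> (g \<oplus>\<^bsub>?G\<^esub> h)"
        by (simp only: add) (simp add: a_assoc E_mem)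
    next
      fix f g assume "f \<in> carrier ?G" "g \<in> carrier ?G"
      then obtain x y where *: "x \<in> E" "y \<in> E" "f = rcls x" "g = rcls y"
        unfolding carr by blast
      then show "f \<oplus>\<^bsub>?G\<^esub> g = g \<oplus>\<^bsub>?G\<^esub> f"
        by (simp only: add) (simp add: a_comm E_mem)
      show "f \<oplus>\<^bsub>?G\<^esub> g \<in> carrier ?G"
        unfolding carr *(3,4) add(1)[OF *(1,2)] using add(2)[OF *(1,2)] by (rule imageI)
    next
      fix f assume "f \<in> carrier ?G"
      then obtain x where *: "x \<in> E" "f = rcls x"
        unfolding carr by blast
      have neg: "(\<lambda>n. \<ominus> x n) \<in> E"
        using *(1) RF.F_a_inv_closed rpart_neg by (auto simp: E_def)
      show "\<zero>\<^bsub>?G\<^esub> \<oplus>\<^bsub>?G\<^esub> f = f"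
        unfolding *(2) zero(1) using * zero by (simp only: add) (simp add: E_mem)
      have "rcls (\<lambda>n. \<ominus> x n) \<oplus>\<^bsub>?G\<^esub> f = \<zero>\<^bsub>?G\<^esub>"
        unfolding *(2) zero(1) using * neg by (simp only: add) (simp add: E_mem l_neg)
      then show "\<exists>g\<in>carrier ?G. g \<oplus>\<^bsub>?G\<^esub> f = \<zero>\<^bsub>?G\<^esub>"
        unfolding carr using neg by blast
    qed (unfold carr zero(1), rule imageI, rule zero(2))
    show "Group.comm_monoid ?G"
    proof (rule comm_monoidI)
      fix f g h assume "f \<in> carrier ?G" "g \<in> carrier ?G" "h \<in> carrier ?G"
      then obtain x y z where *: "x \<in> E" "y \<in> E" "z \<in> E" "f = rcls x" "g = rcls y" "h = rcls z"
        unfolding carr by blast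
      have "conv (regular R) (conv (regular R) x y) z = conv (regular R) x (conv (regular R) y z)"
        using reg.conv_assoc[of x y z] * by (simp add: E_mem fun_eq_iff)
      then show "f \<otimes>\<^bsub>?G\<^esub> g \<otimes>\<^bsub>?G\<^esub> h = f \<otimes>\<^bsub>?G\<^esub> (g \<otimes>\<^bsub>?G\<^esub> h)"
        using * by (simp only: mult)
    next
      fix f g assume "f \<in> carrier ?G" "g \<in> carrier ?G"
      then obtain x y where *: "x \<in> E" "y \<in> E" "f = rcls x" "g = rcls y"
        unfolding carr by blast
      then show "f \<otimes>\<^bsub>?G\<^esub> g = g \<otimes>\<^bsub>?G\<^esub> f"
        using conv_comm[of x y] by (simp only: mult) (simp add: E_mem gr_class_def)
      show "f \<otimes>\<^bsub>?G\<^esub> g \<in> carrier ?G"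
        unfolding carr *(3,4) mult(1)[OF *(1,2)] using mult(2)[OF *(1,2)] by (rule imageI)
    next
      fix f assume "f \<in> carrier ?G"
      then obtain x where *: "x \<in> E" "f = rcls x"
        unfolding carr by blast
      have "conv (regular R) (\<lambda>n. if n = 0 then \<one> else \<zero>) x = x"
        using reg.conv_const[of \<one> x] *(1) by (simp add: E_mem fun_eq_iff)
      then show "\<one>\<^bsub>?G\<^esub> \<otimes>\<^bsub>?G\<^esub> f = f"
        unfolding *(2) one(1) mult(1)[OF one(2) *(1)] by simp
    qed (unfold carr one(1), rule imageI, rule one(2))
    fix f g h assume "f \<in> carrier ?G" "g \<in> carrier ?G" "h \<in> carrier ?G"
    then obtain x y z where *: "x \<in> E" "y \<in> E" "z \<in> E" "f = rcls x" "g = rcls y" "h = rcls z"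
      unfolding carr by blast
    have "conv (regular R) (\<lambda>n. x n \<oplus> y n) z = (\<lambda>n. conv (regular R) x z n \<oplus> conv (regular R) y z n)"
      using reg.conv_add_left[of x y z] * by (simp add: E_mem fun_eq_iff)
    then show "(f \<oplus>\<^bsub>?G\<^esub> g) \<otimes>\<^bsub>?G\<^esub> h = f \<otimes>\<^bsub>?G\<^esub> h \<oplus>\<^bsub>?G\<^esub> g \<otimes>\<^bsub>?G\<^esub> h"
      using * by (simp only: add mult)
  qed
qed

end

section \<open>The associated graded module over the even part\<close>

locale gr_filtered_module = super_module R M + super_nilpotent_ideal R I N
  for R :: "('a, 'm) super_ring_scheme" (structure) and M :: "('a, 'b, 'n) super_module_scheme" (structure)
    and I :: "'a set" and N :: nat
begin

sublocale filtered_module R M I N ..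

abbreviation mcls :: "(nat \<Rightarrow> 'b) \<Rightarrow> nat \<Rightarrow> 'b set" where
  "mcls \<equiv> gr_class M (pow_smult R I M)"

lemma gr_module_carrier: "carrier (gr_module R I M) = mcls ` {x. \<forall>n. x n \<in> pow_smult R I M n}"
  by (simp add: gr_module_def F.gr_carrier_eq)

lemma gr_module_smult:
  assumes "\<And>n. y n \<in> ideal_pow R I n" "\<And>n. x n \<in> pow_smult R I M n"
  shows "rcls y \<odot>\<^bsub>gr_module R I M\<^esub> mcls x = mcls (conv M y x)"
  using gr_smult_class[OF assms] by (simp add: gr_module_def)

lemma gr_module_zero: "\<zero>\<^bsub>gr_module R I M\<^esub> = mcls (\<lambda>n. \<zero>\<^bsub>M\<^esub>)"
  by (simp add: gr_module_def F.gr_class_zero)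

lemma gr_module_add:
  assumes "\<And>n. x n \<in> pow_smult R I M n" "\<And>n. y n \<in> pow_smult R I M n"
  shows "mcls x \<oplus>\<^bsub>gr_module R I M\<^esub> mcls y = mcls (\<lambda>n. x n \<oplus>\<^bsub>M\<^esub> y n)"
  using F.gr_class_add[OF assms[THEN F.F_carrier]] by (simp add: gr_module_def)

lemma gr_even_module: "Module.module (even_ring (gr_ring R I)) (gr_module R I M)"
proof -
  let ?G = "even_ring (gr_ring R I)" and ?N = "gr_module R I M"
  define E where "E = {y. \<forall>n. y n \<in> ideal_pow R I n \<inter> rpart R 0}"
  define X where "X = {x. \<forall>n. x n \<in> pow_smult R I M n}"
  have Gcarr: "carrier ?G = rcls ` E" by (simp add: gr_ring_rpart E_def)
  have carr: "carrier ?N = mcls ` X" by (simp add: gr_module_carrier X_def)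
  have E_mem: "y n \<in> ideal_pow R I n" "y n \<in> rpart R 0" "y n \<in> carrier R" if "y \<in> E" for y n
    using that R.rpart_carrier by (auto simp: E_def)
  have X_mem: "x n \<in> pow_smult R I M n" "x n \<in> carrier M" if "x \<in> X" for x n
    using that F.F_carrier by (auto simp: X_def)
  have mult: "rcls y \<otimes>\<^bsub>?G\<^esub> rcls z = rcls (conv (regular R) y z)" "conv (regular R) y z \<in> E"
    if "y \<in> E" "z \<in> E" for y z
    using gr_ring_mult conv_even conv_regular_ideal_pow that by (auto simp: E_def)
  have add: "rcls y \<oplus>\<^bsub>?G\<^esub> rcls z = rcls (\<lambda>n. y n \<oplus> z n)" "(\<lambda>n. y n \<oplus> z n) \<in> E"
    if "y \<in> E" "z \<in> E" for y z
    using gr_ring_add ideal_pow_a_closed R.rpart_add that by (auto simp: E_def)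
  have smult: "rcls y \<odot>\<^bsub>?N\<^esub> mcls x = mcls (conv M y x)" "conv M y x \<in> X"
    if "y \<in> E" "x \<in> X" for y x
    using gr_module_smult conv_pow_smult that by (auto simp: E_def X_def)
  have madd: "mcls x \<oplus>\<^bsub>?N\<^esub> mcls y = mcls (\<lambda>n. x n \<oplus>\<^bsub>M\<^esub> y n)" "(\<lambda>n. x n \<oplus>\<^bsub>M\<^esub> y n) \<in> X"
    if "x \<in> X" "y \<in> X" for x y
    using gr_module_add F.F_a_closed that by (auto simp: X_def)
  have zero: "\<zero>\<^bsub>?N\<^esub> = mcls (\<lambda>n. \<zero>\<^bsub>M\<^esub>)" "(\<lambda>n. \<zero>\<^bsub>M\<^esub>) \<in> X"
    using gr_module_zero F.F_zero_closed by (auto simp: X_def)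
  show ?thesis
  proof (rule Module.moduleI[OF gr_even_ring_cring])
    show "abelian_group ?N"
    proof (rule abelian_groupI)
      fix f g h assume "f \<in> carrier ?N" "g \<in> carrier ?N" "h \<in> carrier ?N"
      then obtain x y z where "x \<in> X" "y \<in> X" "z \<in> X" "f = mcls x" "g = mcls y" "h = mcls z"
        unfolding carr by blast
      then show "f \<oplus>\<^bsub>?N\<^esub> g \<oplus>\<^bsub>?N\<^esub> h = f \<oplus>\<^bsub>?N\<^esub> (g \<oplus>\<^bsub>?N\<^esub> h)"
        by (simp only: madd) (simp add: M.a_assoc X_mem)
    next
      fix f g assume "f \<in> carrier ?N" "g \<in> carrier ?N"
      then obtain x y where *: "x \<in> X" "y \<in> X" "f = mcls x" "g = mcls y"
        unfolding carr by blast
      then show "f \<oplus>\<^bsub>?N\<^esub> g = g \<oplus>\<^bsub>?N\<^esub> f"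
        by (simp only: madd) (simp add: M.a_comm X_mem)
      show "f \<oplus>\<^bsub>?N\<^esub> g \<in> carrier ?N"
        unfolding carr *(3,4) madd(1)[OF *(1,2)] using madd(2)[OF *(1,2)] by (rule imageI)
    next
      fix f assume "f \<in> carrier ?N"
      then obtain x where *: "x \<in> X" "f = mcls x"
        unfolding carr by blast
      have neg: "(\<lambda>n. \<ominus>\<^bsub>M\<^esub> x n) \<in> X"
        using *(1) F.F_a_inv_closed by (auto simp: X_def)
      show "\<zero>\<^bsub>?N\<^esub> \<oplus>\<^bsub>?N\<^esub> f = f"
        unfolding *(2) zero(1) using * zero by (simp only: madd) (simp add: X_mem)
      have "mcls (\<lambda>n. \<ominus>\<^bsub>M\<^esub> x n) \<oplus>\<^bsub>?N\<^esub> f = \<zero>\<^bsub>?N\<^esub>"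
        unfolding *(2) zero(1) using * neg by (simp only: madd) (simp add: X_mem M.l_neg)
      then show "\<exists>g\<in>carrier ?N. g \<oplus>\<^bsub>?N\<^esub> f = \<zero>\<^bsub>?N\<^esub>"
        unfolding carr using neg by blast
    qed (unfold carr zero(1), rule imageI, rule zero(2))
  next
    fix a v assume "a \<in> carrier ?G" "v \<in> carrier ?N"
    then obtain y x where *: "y \<in> E" "x \<in> X" "a = rcls y" "v = mcls x"
      unfolding carr Gcarr by blast
    show "a \<odot>\<^bsub>?N\<^esub> v \<in> carrier ?N"
      unfolding carr *(3,4) smult(1)[OF *(1,2)] using smult(2)[OF *(1,2)] by (rule imageI)
  next
    fix a b v assume "a \<in> carrier ?G" "b \<in> carrier ?G" "v \<in> carrier ?N"
    then obtain y z x where *: "y \<in> E" "z \<in> E" "x \<in> X" "a = rcls y" "b = rcls z" "v = mcls x"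
      unfolding carr Gcarr by blast
    have "conv M (\<lambda>n. y n \<oplus> z n) x = (\<lambda>n. conv M y x n \<oplus>\<^bsub>M\<^esub> conv M z x n)"
      using conv_add_left[of y z x] * by (simp add: E_mem X_mem fun_eq_iff)
    then show "(a \<oplus>\<^bsub>?G\<^esub> b) \<odot>\<^bsub>?N\<^esub> v = a \<odot>\<^bsub>?N\<^esub> v \<oplus>\<^bsub>?N\<^esub> b \<odot>\<^bsub>?N\<^esub> v"
      using * by (simp only: add madd smult)
    have "conv M (conv (regular R) y z) x = conv M y (conv M z x)"
      using conv_assoc[of y z x] * by (simp add: E_mem X_mem fun_eq_iff)
    then show "(a \<otimes>\<^bsub>?G\<^esub> b) \<odot>\<^bsub>?N\<^esub> v = a \<odot>\<^bsub>?N\<^esub> (b \<odot>\<^bsub>?N\<^esub> v)"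
      using * by (simp only: mult smult)
  next
    fix a v w assume "a \<in> carrier ?G" "v \<in> carrier ?N" "w \<in> carrier ?N"
    then obtain y x z where *: "y \<in> E" "x \<in> X" "z \<in> X" "a = rcls y" "v = mcls x" "w = mcls z"
      unfolding carr Gcarr by blast
    have "conv M y (\<lambda>n. x n \<oplus>\<^bsub>M\<^esub> z n) = (\<lambda>n. conv M y x n \<oplus>\<^bsub>M\<^esub> conv M y z n)"
      using conv_add_right[of y x z] * by (simp add: E_mem X_mem fun_eq_iff)
    then show "a \<odot>\<^bsub>?N\<^esub> (v \<oplus>\<^bsub>?N\<^esub> w) = a \<odot>\<^bsub>?N\<^esub> v \<oplus>\<^bsub>?N\<^esub> a \<odot>\<^bsub>?N\<^esub> w"
      using * by (simp only: madd smult)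
  next
    fix v assume "v \<in> carrier ?N"
    then obtain x where *: "x \<in> X" "v = mcls x" unfolding carr by blast
    have one: "(\<lambda>n. if n = 0 then \<one> else \<zero>) \<in> E"
      using const_ideal_pow[OF one_even] by (auto simp: E_def)
    have "conv M (\<lambda>n. if n = 0 then \<one> else \<zero>) x = x"
      using conv_const[of \<one> x] *(1) by (simp add: X_mem fun_eq_iff smult_one)
    then show "\<one>\<^bsub>?G\<^esub> \<odot>\<^bsub>?N\<^esub> v = v"
      using smult(1)[OF one *(1)] *(2) by (simp add: gr_ring_one)
  qed
qed

end

section \<open>Prime ideals of the associated graded ring\<close>

lemma (in cring) ideal_cringI:
  assumes "H \<subseteq> carrier R" "\<zero> \<in> H" "\<And>a b. a \<in> H \<Longrightarrow> b \<in> H \<Longrightarrow> a \<oplus> b \<in> H"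
    and absorb: "\<And>r a. r \<in> carrier R \<Longrightarrow> a \<in> H \<Longrightarrow> r \<otimes> a \<in> H"
  shows "ideal H R"
proof (rule idealI[OF ring_axioms])
  show "subgroup H (add_monoid R)"
  proof (rule add.subgroupI)
    fix a assume a: "a \<in> H"
    then have "\<ominus> a = \<ominus> \<one> \<otimes> a" using assms(1) by (auto simp: l_minus)
    then show "\<ominus> a \<in> H" using absorb[OF _ a, of "\<ominus> \<one>"] by simp
  qed (use assms in auto)
next
  fix a x assume ax: "a \<in> H" "x \<in> carrier R"
  then show "x \<otimes> a \<in> H" using absorb by blast
  then show "a \<otimes> x \<in> H" using ax assms(1) m_comm[of a x] by auto
qed

lemma (in primeideal) one_notin: "\<one> \<notin> I"
  using I_notcarr one_imp_carrier by blast

lemma (in primeideal) nat_pow_mem: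
  assumes "a \<in> carrier R" "a [^] (n::nat) \<in> I"
  shows "a \<in> I"
  using assms(2)
proof (induction n)
  case 0
  then show ?case using one_notin by simp
next
  case (Suc n)
  then show ?case using I_prime[of "a [^] n" a] assms(1) by auto
qed

lemma even_ring_nat_pow: "a [^]\<^bsub>even_ring R\<^esub> (n::nat) = a [^]\<^bsub>R\<^esub> n"
  by (simp add: nat_pow_def even_ring_def)

context super_nilpotent_ideal begin

abbreviation even_seqs :: "(nat \<Rightarrow> 'a) set" where
  "even_seqs \<equiv> {y. \<forall>n. y n \<in> ideal_pow R I n \<inter> rpart R 0}"

abbreviation const_seq :: "'a \<Rightarrow> nat \<Rightarrow> 'a" where
  "const_seq a \<equiv> \<lambda>n. if n = 0 then a else \<zero>"

lemma const_seq_even: "a \<in> rpart R 0 \<Longrightarrow> const_seq a \<in> even_seqs"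
  using const_ideal_pow by blast

lemma even_seqs_carrier: "y \<in> even_seqs \<Longrightarrow> y n \<in> carrier R"
  using rpart_carrier by blast

lemma gr_even_carrier: "carrier (even_ring (gr_ring R I)) = rcls ` even_seqs"
  by (simp add: gr_ring_rpart)

lemma conv_regular_const_seq:
  assumes "a \<in> carrier R" "\<And>n. z n \<in> carrier R"
  shows "conv (regular R) (const_seq a) z = (\<lambda>n. a \<otimes> z n)"
proof -
  interpret reg: left_module R "regular R" by (rule left_module_regular)
  show ?thesis using reg.conv_const[of a z] assms by (simp add: fun_eq_iff)
qed

lemma even_mult:
  assumes "y \<in> even_seqs" "z \<in> even_seqs"
  shows "rcls y \<otimes>\<^bsub>gr_ring R I\<^esub> rcls z = rcls (conv (regular R) y z)" "conv (regular R) y z \<in> even_seqs"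
  using assms gr_ring_mult conv_regular_ideal_pow conv_even by auto

lemma even_add:
  assumes "y \<in> even_seqs" "z \<in> even_seqs"
  shows "rcls y \<oplus>\<^bsub>gr_ring R I\<^esub> rcls z = rcls (\<lambda>n. y n \<oplus> z n)" "(\<lambda>n. y n \<oplus> z n) \<in> even_seqs"
  using assms gr_ring_add ideal_pow_a_closed rpart_add by auto

text \<open>This is reduction modulo the even part of \<open>I\<close>, followed by the inclusion of
  degree 0. Defined on all of \<open>R_0\<close>, it pulls primes back to \<open>R_0\<close>
  directly, and the quotient is never formed.\<close>

lemma const_seq_hom: "ring_hom_ring (even_ring R) (even_ring (gr_ring R I)) (\<lambda>a. rcls (const_seq a))"
proof (rule ring_hom_ringI2)
  show "ring (even_ring R)" "ring (even_ring (gr_ring R I))"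
    using even_ring_cring gr_even_ring_cring by (auto intro: cring.axioms)
  show "(\<lambda>a. rcls (const_seq a)) \<in> ring_hom (even_ring R) (even_ring (gr_ring R I))"
  proof (rule ring_hom_memI)
    fix a assume "a \<in> carrier (even_ring R)"
    then show "rcls (const_seq a) \<in> carrier (even_ring (gr_ring R I))"
      unfolding gr_even_carrier using const_seq_even by auto
  next
    fix a b assume "a \<in> carrier (even_ring R)" "b \<in> carrier (even_ring R)"
    then have ab: "const_seq a \<in> even_seqs" "const_seq b \<in> even_seqs" "a \<in> carrier R" "b \<in> carrier R"
      using const_seq_even rpart_carrier by auto
    have "conv (regular R) (const_seq a) (const_seq b) = const_seq (a \<otimes> b)"
      using conv_regular_const_seq[of a "const_seq b"] ab by (auto simp: fun_eq_iff)
    then show "rcls (const_seq (a \<otimes>\<^bsub>even_ring R\<^esub> b)) =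
        rcls (const_seq a) \<otimes>\<^bsub>even_ring (gr_ring R I)\<^esub> rcls (const_seq b)"
      unfolding even_ring_simps using even_mult(1)[OF ab(1,2)] by simp
    have "(\<lambda>n. const_seq a n \<oplus> const_seq b n) = const_seq (a \<oplus> b)"
      using ab by (auto simp: fun_eq_iff)
    then show "rcls (const_seq (a \<oplus>\<^bsub>even_ring R\<^esub> b)) =
        rcls (const_seq a) \<oplus>\<^bsub>even_ring (gr_ring R I)\<^esub> rcls (const_seq b)"
      unfolding even_ring_simps using even_add(1)[OF ab(1,2)] by simp
  qed (simp only: gr_ring_one even_ring_simps)
qed

text \<open>The image of \<open>p\<close> in degree 0 together with everything even in positive
  degrees. That membership does not depend on the representative is a property of primes, shown in
  \<open>rcls_in_lift_iff\<close>.\<close>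

definition lift_prime :: "'a set \<Rightarrow> (nat \<Rightarrow> 'a set) set" where
  "lift_prime p = rcls ` {y \<in> even_seqs. y 0 \<in> p}"

definition pull_prime :: "(nat \<Rightarrow> 'a set) set \<Rightarrow> 'a set" where
  "pull_prime P = {a \<in> carrier (even_ring R). rcls (const_seq a) \<in> P}"

lemma pull_primeideal: "primeideal P (even_ring (gr_ring R I)) \<Longrightarrow> primeideal (pull_prime P) (even_ring R)"
  unfolding pull_prime_def by (rule ring_hom_ring.primeideal_vimage[OF const_seq_hom even_ring_cring])

text \<open>The \<open>N\<close>-th power of \<open>a\<close> lies in \<open>I^N\<close>, which is
  zero, hence in \<open>p\<close>.\<close>

lemma nil_in_prime:
  assumes p: "primeideal p (even_ring R)" and a: "a \<in> I" "a \<in> rpart R 0"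
  shows "a \<in> p"
proof -
  interpret p: primeideal p "even_ring R" by fact
  note p_zero = additive_subgroup.zero_closed[OF p.is_additive_subgroup, unfolded even_ring_simps]
  have one: "ideal_pow R I (Suc 0) = I"
    using ideal_prod_one[OF is_ideal] by (simp add: ideal_pow.simps)
  have "a [^] n \<in> ideal_pow R I n" for n :: nat
  proof (induction n)
    case (Suc n)
    then show ?case
      using ideal_pow_mult[of "a [^] n" n a "Suc 0"] one a by simp
  qed simp
  from this[of N] have "a [^]\<^bsub>even_ring R\<^esub> N = \<zero>\<^bsub>even_ring R\<^esub>"
    by (simp add: nilpotent even_ring_nat_pow)
  then have "a [^]\<^bsub>even_ring R\<^esub> N \<in> p" using p_zero by simp
  then show ?thesis
    using p.nat_pow_mem[of a N] a by simp
qed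

text \<open>A class in the lift may come from another representative. Two representatives differ in
  degree 0 by an even element of \<open>I\<close>, and such elements lie in every prime of
  \<open>R_0\<close>.\<close>

lemma rcls_in_lift_iff:
  assumes p: "primeideal p (even_ring R)" and y: "y \<in> even_seqs"
  shows "rcls y \<in> lift_prime p \<longleftrightarrow> y 0 \<in> p"
proof
  interpret p: primeideal p "even_ring R" by fact
  note p_add = additive_subgroup.a_closed[OF p.is_additive_subgroup, unfolded even_ring_simps]
  assume "rcls y \<in> lift_prime p"
  then obtain z where z: "z \<in> even_seqs" "z 0 \<in> p" "rcls y = rcls z"
    unfolding lift_prime_def by blast
  have yz: "y 0 \<in> carrier R" "z 0 \<in> carrier R" "y 0 \<in> rpart R 0" "z 0 \<in> rpart R 0"
    using even_seqs_carrier[OF y] even_seqs_carrier[OF z(1)] y z(1) by auto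
  have "y 0 \<oplus> \<ominus> z 0 \<in> ideal_pow R I (Suc 0)"
    using z(3) RF.gr_class_eq_iff[of y z] even_seqs_carrier[OF y] even_seqs_carrier[OF z(1)] by blast
  then have "y 0 \<oplus> \<ominus> z 0 \<in> I"
    using ideal_prod_one[OF is_ideal] by (simp add: ideal_pow.simps)
  moreover have "y 0 \<oplus> \<ominus> z 0 \<in> rpart R 0"
    using yz rpart_add rpart_neg by blast
  ultimately have "y 0 \<oplus> \<ominus> z 0 \<in> p"
    using nil_in_prime[OF p] by blast
  then have "(y 0 \<oplus> \<ominus> z 0) \<oplus> z 0 \<in> p"
    using p_add[of "y 0 \<oplus> \<ominus> z 0" "z 0"] z(2) by simp
  then show "y 0 \<in> p"
    using yz by (simp add: a_assoc l_neg)
qed (use y in \<open>auto simp: lift_prime_def\<close>)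

lemma lift_primeideal:
  assumes p: "primeideal p (even_ring R)"
  shows "primeideal (lift_prime p) (even_ring (gr_ring R I))"
proof -
  interpret p: primeideal p "even_ring R" by fact
  note p_zero = additive_subgroup.zero_closed[OF p.is_additive_subgroup, unfolded even_ring_simps]
    and p_add = additive_subgroup.a_closed[OF p.is_additive_subgroup, unfolded even_ring_simps]
  interpret G: cring "even_ring (gr_ring R I)" by (rule gr_even_ring_cring)
  \<comment> \<open>Taking the component of degree 0 is multiplicative, so absorption and primality
    of the lift reduce to those of \<open>p\<close>.\<close>
  have conv0: "conv (regular R) y z 0 = y 0 \<otimes> z 0" if "y \<in> even_seqs" "z \<in> even_seqs" for y z
    using even_seqs_carrier[OF that(1)] even_seqs_carrier[OF that(2)] by (simp add: conv_def)
  show ?thesis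
  proof (rule primeidealI)
    show "ideal (lift_prime p) (even_ring (gr_ring R I))"
    proof (rule G.ideal_cringI)
      show "lift_prime p \<subseteq> carrier (even_ring (gr_ring R I))"
        unfolding gr_even_carrier lift_prime_def by blast
      have "const_seq \<zero> \<in> even_seqs" using const_seq_even[OF rpart_zero] .
      then show "\<zero>\<^bsub>even_ring (gr_ring R I)\<^esub> \<in> lift_prime p"
        using rcls_in_lift_iff[OF p, of "const_seq \<zero>"] p_zero by (simp add: gr_ring_zero)
    next
      fix f g assume "f \<in> lift_prime p" "g \<in> lift_prime p"
      then obtain y z where *: "y \<in> even_seqs" "y 0 \<in> p" "z \<in> even_seqs" "z 0 \<in> p" "f = rcls y" "g = rcls z"
        unfolding lift_prime_def by blast
      then have "rcls (\<lambda>n. y n \<oplus> z n) \<in> lift_prime p"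
        using rcls_in_lift_iff[OF p even_add(2)[of y z]] p_add[of "y 0" "z 0"] by simp
      then show "f \<oplus>\<^bsub>even_ring (gr_ring R I)\<^esub> g \<in> lift_prime p"
        using even_add(1)[of y z] * by simp
    next
      fix f g assume "f \<in> carrier (even_ring (gr_ring R I))" "g \<in> lift_prime p"
      then obtain y z where *: "y \<in> even_seqs" "z \<in> even_seqs" "z 0 \<in> p" "f = rcls y" "g = rcls z"
        unfolding lift_prime_def gr_even_carrier by blast
      then have "rcls (conv (regular R) y z) \<in> lift_prime p"
        using rcls_in_lift_iff[OF p even_mult(2)[of y z]] p.I_l_closed[of "z 0" "y 0"] conv0 by simp
      then show "f \<otimes>\<^bsub>even_ring (gr_ring R I)\<^esub> g \<in> lift_prime p"
        using even_mult(1)[of y z] * by simp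
    qed
    have "\<one>\<^bsub>even_ring (gr_ring R I)\<^esub> \<notin> lift_prime p"
      using rcls_in_lift_iff[OF p const_seq_even[OF one_even]] p.one_notin by (simp add: gr_ring_one)
    then show "carrier (even_ring (gr_ring R I)) \<noteq> lift_prime p"
      using G.one_closed by metis
  next
    fix f g assume "f \<in> carrier (even_ring (gr_ring R I))" "g \<in> carrier (even_ring (gr_ring R I))"
      and fg: "f \<otimes>\<^bsub>even_ring (gr_ring R I)\<^esub> g \<in> lift_prime p"
    then obtain y z where *: "y \<in> even_seqs" "z \<in> even_seqs" "f = rcls y" "g = rcls z"
      unfolding gr_even_carrier by blast
    with fg have "rcls (conv (regular R) y z) \<in> lift_prime p"
      using even_mult(1)[of y z] by simp
    then have "y 0 \<otimes> z 0 \<in> p"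
      using rcls_in_lift_iff[OF p even_mult(2)[of y z]] * conv0 by simp
    then show "f \<in> lift_prime p \<or> g \<in> lift_prime p"
      using p.I_prime[of "y 0" "z 0"] rcls_in_lift_iff[OF p *(1)] rcls_in_lift_iff[OF p *(2)] * by auto
  qed (rule gr_even_ring_cring)
qed

text \<open>An element of positive degree is nilpotent, since its \<open>k\<close>-th power lives in degrees at least \<open>k\<close>.\<close>

lemma positive_degree_in_prime:
  assumes P: "primeideal P (even_ring (gr_ring R I))" and y: "y \<in> even_seqs" "y 0 = \<zero>"
  shows "rcls y \<in> P"
proof -
  interpret P: primeideal P "even_ring (gr_ring R I)" by fact
  note P_zero = additive_subgroup.zero_closed[OF P.is_additive_subgroup, unfolded even_ring_simps]
  have "\<exists>w\<in>even_seqs. (\<forall>n<k. w n = \<zero>) \<and> rcls y [^]\<^bsub>even_ring (gr_ring R I)\<^esub> k = rcls w" for k :: nat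
  proof (induction k)
    case 0
    then show ?case
      using const_seq_even[OF one_even] by (intro bexI[of _ "const_seq \<one>"]) (auto simp: gr_ring_one)
  next
    case (Suc k)
    then obtain w where w: "w \<in> even_seqs" "\<forall>n<k. w n = \<zero>"
      "rcls y [^]\<^bsub>even_ring (gr_ring R I)\<^esub> k = rcls w" by blast
    have "conv (regular R) w y n = \<zero>" if n: "n < Suc k" for n
    proof -
      have "w i \<otimes> y (n - i) = \<zero>" if "i \<le> n" for i
      proof (cases "i < k")
        case True
        then show ?thesis using w(2) even_seqs_carrier[OF y(1)] by simp
      next
        case False
        then have "n - i = 0" using n by auto
        then show ?thesis using y(2) even_seqs_carrier[OF w(1)] by simp
      qed
      then have "(\<Oplus>i\<in>{..n}. w i \<otimes> y (n - i)) = (\<Oplus>i\<in>{..n}. \<zero>)"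
        by (intro finsum_cong') auto
      then show ?thesis by (simp add: conv_def)
    qed
    then show ?case
      using even_mult[OF w(1) y(1)] w(3) by (intro bexI[of _ "conv (regular R) w y"]) auto
  qed
  then obtain w where w: "w \<in> even_seqs" "\<forall>n<N. w n = \<zero>"
    "rcls y [^]\<^bsub>even_ring (gr_ring R I)\<^esub> N = rcls w" by blast
  \<comment> \<open>Components below \<open>N\<close> vanish by degree, those from \<open>N\<close>
    on because the powers of \<open>I\<close> are zero there.\<close>
  have "w n = \<zero>" for n
    using w(1,2) ideal_pow_eq_0[of n] by (cases "n < N") auto
  then have "w = (\<lambda>n. \<zero>)" by blast
  then have "rcls y [^]\<^bsub>even_ring (gr_ring R I)\<^esub> N \<in> P"
    using w(3) P_zero by (simp add: gr_ring_zero)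
  then show ?thesis
    using P.nat_pow_mem[of "rcls y" N] y(1) unfolding gr_even_carrier by blast
qed

text \<open>The part of \<open>y\<close> in positive degrees lies in every prime, so modulo
  \<open>P\<close> only the component of degree 0 counts. In particular \<open>P\<close> is
  determined by its contraction.\<close>

lemma rcls_in_prime_iff:
  assumes P: "primeideal P (even_ring (gr_ring R I))" and y: "y \<in> even_seqs"
  shows "rcls y \<in> P \<longleftrightarrow> y 0 \<in> pull_prime P"
proof -
  interpret P: primeideal P "even_ring (gr_ring R I)" by fact
  note P_add = additive_subgroup.a_closed[OF P.is_additive_subgroup]
    and P_neg = additive_subgroup.a_inv_closed[OF P.is_additive_subgroup]
  define u where "u = (\<lambda>n. if n = 0 then \<zero> else y n)"
  have y0: "y 0 \<in> rpart R 0" using y by auto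
  have u: "u \<in> even_seqs" using y ideal_pow_zero rpart_zero by (auto simp: u_def)
  have c: "const_seq (y 0) \<in> even_seqs" using const_seq_even[OF y0] .
  have "(\<lambda>n. const_seq (y 0) n \<oplus> u n) = y"
    using even_seqs_carrier[OF y] by (auto simp: u_def)
  then have split: "rcls y = rcls (const_seq (y 0)) \<oplus>\<^bsub>even_ring (gr_ring R I)\<^esub> rcls u"
    using even_add(1)[OF c u] by simp
  have uP: "rcls u \<in> P"
    using positive_degree_in_prime[OF P u] by (simp add: u_def)
  have carr: "rcls u \<in> carrier (even_ring (gr_ring R I))"
    "rcls (const_seq (y 0)) \<in> carrier (even_ring (gr_ring R I))"
    unfolding gr_even_carrier using u c by auto
  have "rcls y \<in> P \<longleftrightarrow> rcls (const_seq (y 0)) \<in> P"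
  proof
    assume "rcls y \<in> P"
    then have "rcls y \<oplus>\<^bsub>even_ring (gr_ring R I)\<^esub> \<ominus>\<^bsub>even_ring (gr_ring R I)\<^esub> rcls u \<in> P"
      using P_add P_neg uP by blast
    then show "rcls (const_seq (y 0)) \<in> P"
      unfolding split using carr by (simp add: P.a_assoc P.r_neg del: even_ring_simps)
  next
    assume "rcls (const_seq (y 0)) \<in> P"
    then show "rcls y \<in> P"
      unfolding split using P_add uP by blast
  qed
  then show ?thesis using y0 by (simp add: pull_prime_def)
qed

lemma pull_mono: "P \<subseteq> Q \<Longrightarrow> pull_prime P \<subseteq> pull_prime Q"
  by (auto simp: pull_prime_def)

text \<open>A contraction could in general identify two primes. Here the component of degree 0 of an
  element separating \<open>P\<close> from \<open>Q\<close> separates their contractions.\<close>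

lemma pull_strict_mono:
  assumes P: "primeideal P (even_ring (gr_ring R I))" and Q: "primeideal Q (even_ring (gr_ring R I))"
    and "P \<subset> Q"
  shows "pull_prime P \<subset> pull_prime Q"
proof -
  obtain f where f: "f \<in> Q" "f \<notin> P" using assms(3) by blast
  then have "f \<in> carrier (even_ring (gr_ring R I))"
    using ideal.Icarr[OF primeideal.axioms(1)[OF Q]] by blast
  then obtain y where y: "y \<in> even_seqs" "f = rcls y" unfolding gr_even_carrier by blast
  then have "y 0 \<in> pull_prime Q" "y 0 \<notin> pull_prime P"
    using f rcls_in_prime_iff[OF P y(1)] rcls_in_prime_iff[OF Q y(1)] by auto
  then show ?thesis using pull_mono assms(3) by blast
qed

lemma lift_strict_mono:
  assumes p: "primeideal p (even_ring R)" and q: "primeideal q (even_ring R)" and "p \<subset> q"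
  shows "lift_prime p \<subset> lift_prime q"
proof -
  obtain a where a: "a \<in> q" "a \<notin> p" using assms(3) by blast
  then have "a \<in> rpart R 0"
    using ideal.Icarr[OF primeideal.axioms(1)[OF q]] by auto
  then have "const_seq a \<in> even_seqs" by (rule const_seq_even)
  then have "rcls (const_seq a) \<in> lift_prime q" "rcls (const_seq a) \<notin> lift_prime p"
    using rcls_in_lift_iff[OF p] rcls_in_lift_iff[OF q] a by auto
  moreover have "lift_prime p \<subseteq> lift_prime q" using assms(3) by (auto simp: lift_prime_def)
  ultimately show ?thesis by blast
qed

end

section \<open>Comparison of the dimensions\<close>

context gr_filtered_module begin

abbreviation filt_seqs :: "(nat \<Rightarrow> 'b) set" where
  "filt_seqs \<equiv> {x. \<forall>n. x n \<in> pow_smult R I M n}"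

lemma filt_seqs_carrier: "x \<in> filt_seqs \<Longrightarrow> x n \<in> carrier M"
  using F.F_carrier by blast

lemma const_seq_smult:
  assumes "a \<in> rpart R 0" "x \<in> filt_seqs"
  shows "rcls (const_seq a) \<odot>\<^bsub>gr_module R I M\<^esub> mcls x = mcls (\<lambda>n. a \<odot>\<^bsub>M\<^esub> x n)"
proof -
  have "conv M (const_seq a) x = (\<lambda>n. a \<odot>\<^bsub>M\<^esub> x n)"
    using conv_const[of a x] assms rpart_carrier filt_seqs_carrier by (simp add: fun_eq_iff)
  then show ?thesis
    using gr_module_smult[of "const_seq a" x] const_seq_even[OF assms(1)] assms(2) by simp
qed

lemma ann_subset_pull:
  assumes "ann_even (gr_ring R I) (gr_module R I M) \<subseteq> P"
  shows "ann_even R M \<subseteq> pull_prime P"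
proof
  fix a assume a: "a \<in> ann_even R M"
  then have a0: "a \<in> rpart R 0" and ann: "\<And>x. x \<in> carrier M \<Longrightarrow> a \<odot>\<^bsub>M\<^esub> x = \<zero>\<^bsub>M\<^esub>"
    by (auto simp: ann_even_def)
  have "rcls (const_seq a) \<odot>\<^bsub>gr_module R I M\<^esub> v = \<zero>\<^bsub>gr_module R I M\<^esub>"
    if "v \<in> carrier (gr_module R I M)" for v
  proof -
    obtain x where x: "x \<in> filt_seqs" "v = mcls x" using \<open>v \<in> _\<close> unfolding gr_module_carrier by blast
    then show ?thesis
      using const_seq_smult[OF a0 x(1)] ann filt_seqs_carrier[OF x(1)] by (simp add: gr_module_zero)
  qed
  then have "rcls (const_seq a) \<in> ann_even (gr_ring R I) (gr_module R I M)"
    using const_seq_even[OF a0] by (auto simp: ann_even_def gr_ring_rpart)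
  then show "a \<in> pull_prime P"
    using assms a0 by (auto simp: pull_prime_def)
qed

text \<open>If \<open>f\<close> annihilates the graded module, its component of degree 0 raises the filtration of \<open>M\<close>,
  so some power of it annihilates \<open>M\<close>.\<close>

lemma ann_subset_lift:
  assumes p: "primeideal p (even_ring R)" and ann: "ann_even R M \<subseteq> p"
  shows "ann_even (gr_ring R I) (gr_module R I M) \<subseteq> lift_prime p"
proof
  interpret p: primeideal p "even_ring R" by fact
  fix f assume f: "f \<in> ann_even (gr_ring R I) (gr_module R I M)"
  then obtain y where y: "y \<in> even_seqs" "f = rcls y"
    unfolding ann_even_def gr_ring_rpart by blast
  have y0: "y 0 \<in> rpart R 0" using y by auto
  note y0c = rpart_carrier[OF y0]
  have raise: "y 0 \<odot>\<^bsub>M\<^esub> x \<in> pow_smult R I M (Suc k)" if x: "x \<in> pow_smult R I M k" for x k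
  proof -
    \<comment> \<open>An element concentrated in degree \<open>k\<close> isolates
      \<open>y 0\<close>: in degree \<open>k\<close> of the product no other component of
      \<open>y\<close> contributes.\<close>
    let ?x = "\<lambda>n. if n = k then x else \<zero>\<^bsub>M\<^esub>"
    have xX: "?x \<in> filt_seqs" using x F.F_zero_closed by auto
    then have "mcls ?x \<in> carrier (gr_module R I M)" unfolding gr_module_carrier by blast
    then have "rcls y \<odot>\<^bsub>gr_module R I M\<^esub> mcls ?x = \<zero>\<^bsub>gr_module R I M\<^esub>"
      using f y(2) by (simp add: ann_even_def)
    then have "mcls (conv M y ?x) k = \<zero>\<^bsub>gr_module R I M\<^esub> k"
      using gr_module_smult[of y ?x] y(1) xX by simp
    then have "pow_smult R I M (Suc k) +>\<^bsub>M\<^esub> (y 0 \<odot>\<^bsub>M\<^esub> x) = pow_smult R I M (Suc k)"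
      using conv_concentrated[of y x k] even_seqs_carrier[OF y(1)] F.F_carrier[OF x]
      by (simp add: gr_class_def gr_module_def)
    then show ?thesis
      using F.coset_eq_zero_iff smult_closed[OF y0c F.F_carrier[OF x]] by blast
  qed
  have "y 0 [^] k \<odot>\<^bsub>M\<^esub> x \<in> pow_smult R I M k" if x: "x \<in> carrier M" for x and k :: nat
  proof (induction k)
    case 0
    then show ?case using pow_smult_gen[of \<one> 0 x] x smult_one by simp
  next
    case (Suc k)
    have "y 0 [^] Suc k \<odot>\<^bsub>M\<^esub> x = y 0 \<odot>\<^bsub>M\<^esub> (y 0 [^] k \<odot>\<^bsub>M\<^esub> x)"
      unfolding nat_pow_Suc2[OF y0c] using y0c x by (simp add: smult_assoc)
    with raise[OF Suc] show ?case by simp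
  qed
  \<comment> \<open>The exponent is \<open>N\<close> because \<open>I^N M\<close> is zero.\<close>
  from this[of _ N] have kill: "y 0 [^] N \<odot>\<^bsub>M\<^esub> x = \<zero>\<^bsub>M\<^esub>" if "x \<in> carrier M" for x
    using that F.F_zero[of N] by simp
  have "y 0 [^] N \<in> rpart R 0"
    using p.nat_pow_closed[of "y 0" N] y0 by (simp add: even_ring_nat_pow)
  then have "y 0 [^]\<^bsub>even_ring R\<^esub> N \<in> p"
    using ann kill by (auto simp: ann_even_def even_ring_nat_pow)
  then have "y 0 \<in> p"
    using p.nat_pow_mem[of "y 0" N] y0 by simp
  then show "f \<in> lift_prime p"
    using rcls_in_lift_iff[OF p y(1)] y(2) by simp
qed

lemma prime_chain_gr_iff:
  "prime_chain (even_ring (gr_ring R I)) (ann_even (gr_ring R I) (gr_module R I M)) n \<longleftrightarrow>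
    prime_chain (even_ring R) (ann_even R M) n"
proof
  assume "prime_chain (even_ring (gr_ring R I)) (ann_even (gr_ring R I) (gr_module R I M)) n"
  then show "prime_chain (even_ring R) (ann_even R M) n"
    by (rule prime_chain_transfer[where \<phi> = pull_prime])
      (simp_all add: pull_primeideal ann_subset_pull pull_strict_mono)
next
  assume "prime_chain (even_ring R) (ann_even R M) n"
  then show "prime_chain (even_ring (gr_ring R I)) (ann_even (gr_ring R I) (gr_module R I M)) n"
    by (rule prime_chain_transfer[where \<phi> = lift_prime])
      (simp_all add: lift_primeideal ann_subset_lift lift_strict_mono)
qed

lemma sm_dim_prime_chain:
  assumes "T \<subseteq> carrier M"
  shows "sm_dim R (M\<lparr>carrier := T\<rparr>) =
    (SUP n \<in> {n. prime_chain (even_ring R) (ann_even R (M\<lparr>carrier := T\<rparr>)) n}. ereal (real n))"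
  by (rule sm_dim_eq_prime_chain[OF even_module assms])

lemma sm_dim_gr: "sm_dim (gr_ring R I) (gr_module R I M) = sm_dim R M"
  using sm_dim_eq_prime_chain[OF gr_even_module, OF subset_refl] sm_dim_prime_chain[OF subset_refl]
  by (simp add: prime_chain_gr_iff)

text \<open>The descending induction on \<open>k\<close> multiplies the factors of \<open>fs\<close> from the right; at each step the
  representatives of the partial product lie in a set \<open>B k\<close> that absorbs one more odd factor.\<close>

lemma foldr_gr_representative:
  assumes "set fs \<subseteq> rpart (gr_ring R I) 1" "length fs + k = l" "\<one> \<in> B l"
    and zero: "\<And>k. \<zero> \<in> B k"
    and add: "\<And>k y z. y \<in> B k \<Longrightarrow> z \<in> B k \<Longrightarrow> y \<oplus> z \<in> B k"
    and carr: "\<And>k. B k \<subseteq> carrier R"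
    and mult: "\<And>k y z. y \<in> rpart R 1 \<Longrightarrow> z \<in> B (Suc k) \<Longrightarrow> y \<otimes> z \<in> B k"
  shows "\<exists>z. (\<forall>n. z n \<in> ideal_pow R I n \<inter> B k) \<and>
    foldr (\<otimes>\<^bsub>gr_ring R I\<^esub>) fs \<one>\<^bsub>gr_ring R I\<^esub> = rcls z"
  using assms(1,2)
proof (induction fs arbitrary: k)
  case Nil
  then show ?case
    using const_seq_even[OF one_even] assms(3) zero by (intro exI[of _ "const_seq \<one>"]) (auto simp: gr_ring_one)
next
  case (Cons f fs)
  obtain z where z: "\<And>n. z n \<in> ideal_pow R I n" "\<And>n. z n \<in> B (Suc k)"
    "foldr (\<otimes>\<^bsub>gr_ring R I\<^esub>) fs \<one>\<^bsub>gr_ring R I\<^esub> = rcls z"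
    using Cons.IH[of "Suc k"] Cons.prems by auto
  obtain y where y: "\<And>n. y n \<in> ideal_pow R I n" "\<And>n. y n \<in> rpart R 1" "f = rcls y"
    using Cons.prems(1) by (auto simp: gr_ring_rpart)
  have "(\<Oplus>i\<in>A. y i \<otimes> z (n - i)) \<in> B k" if "finite A" for A n
    using that
  proof (induction A rule: finite_induct)
    case (insert i A)
    then show ?case
      using add[OF mult[OF y(2) z(2)[of "n - i"]] insert.IH, of i] y(1)[THEN ideal_pow_carrier]
        z(1)[THEN ideal_pow_carrier] by (simp add: Pi_def)
  qed (simp add: zero)
  then have "conv (regular R) y z n \<in> B k" for n
    by (simp add: conv_def)
  then show ?case
    using conv_regular_ideal_pow[OF y(1) z(1)] gr_ring_mult[OF y(1) z(1)] y(3) z(3)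
    by (intro exI[of _ "conv (regular R) y z"]) simp
qed

lemma foldr_smult_closed:
  assumes fs: "set fs \<subseteq> rpart (gr_ring R I) 1" and v: "v \<in> carrier (gr_module R I M)"
  shows "foldr (\<otimes>\<^bsub>gr_ring R I\<^esub>) fs \<one>\<^bsub>gr_ring R I\<^esub> \<odot>\<^bsub>gr_module R I M\<^esub> v \<in> carrier (gr_module R I M)"
proof -
  \<comment> \<open>With \<open>B\<close> constantly the carrier, what remains of the lemma is the
    existence of representatives compatible with the filtration.\<close>
  obtain z where z: "\<And>n. z n \<in> ideal_pow R I n"
    "foldr (\<otimes>\<^bsub>gr_ring R I\<^esub>) fs \<one>\<^bsub>gr_ring R I\<^esub> = rcls z"
    using foldr_gr_representative[OF fs, of 0 "length fs" "\<lambda>_. carrier R"] rpart_carrier by auto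
  obtain x where x: "x \<in> filt_seqs" "v = mcls x" using v unfolding gr_module_carrier by blast
  have "rcls z \<odot>\<^bsub>gr_module R I M\<^esub> mcls x = mcls (conv M z x)" "conv M z x \<in> filt_seqs"
    using gr_module_smult[of z x] conv_pow_smult[of z x] z(1) x(1) by auto
  then show ?thesis
    unfolding z(2) x(2) gr_module_carrier by simp
qed

lemma odd_list_below_prime:
  assumes fs: "set fs \<subseteq> rpart (gr_ring R I) 1"
    and P: "primeideal P (even_ring (gr_ring R I))"
    and ann: "ann_even (gr_ring R I) (gr_module R I M\<lparr>carrier :=
      (\<lambda>x. foldr (\<otimes>\<^bsub>gr_ring R I\<^esub>) fs \<one>\<^bsub>gr_ring R I\<^esub> \<odot>\<^bsub>gr_module R I M\<^esub> x) ` carrier (gr_module R I M)\<rparr>)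
      \<subseteq> P"
  shows "\<exists>ys. length ys = length fs \<and> set ys \<subseteq> rpart R 1 \<and>
    ann_even R (M\<lparr>carrier := (\<lambda>x. foldr (\<otimes>) ys \<one> \<odot>\<^bsub>M\<^esub> x) ` carrier M\<rparr>) \<subseteq> pull_prime P"
proof (rule ccontr)
  assume none: "\<not> ?thesis"
  define p where "p = pull_prime P"
  interpret p: primeideal p "even_ring R"
    unfolding p_def by (rule pull_primeideal[OF P])
  have pcl: "a \<otimes> b \<in> rpart R 0 - p" if "a \<in> rpart R 0 - p" "b \<in> rpart R 0 - p" for a b
    using that p.I_prime[of a b] part_mult[of a 0 b 0] by auto
  have one_p: "\<one> \<in> rpart R 0 - p"
    using one_even p.one_notin by simp
  \<comment> \<open>These are the elements acting as zero on \<open>M\<close> after localisation at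
    \<open>p\<close>, in a uniform form: one element outside \<open>p\<close> kills the whole image.
    Even elements are central, so a product of two such killers kills what either kills, and
    \<open>K\<close> is closed under sums.\<close>
  define K where "K = {z \<in> carrier R. \<exists>a\<in>rpart R 0 - p. \<forall>x\<in>carrier M. a \<odot>\<^bsub>M\<^esub> (z \<odot>\<^bsub>M\<^esub> x) = \<zero>\<^bsub>M\<^esub>}"
  have common: "(\<forall>x\<in>carrier M. (a \<otimes> b) \<odot>\<^bsub>M\<^esub> (z \<odot>\<^bsub>M\<^esub> x) = \<zero>\<^bsub>M\<^esub>)"
    if "z \<in> carrier R" "a \<in> rpart R 0" "b \<in> rpart R 0"
      "(\<forall>x\<in>carrier M. a \<odot>\<^bsub>M\<^esub> (z \<odot>\<^bsub>M\<^esub> x) = \<zero>\<^bsub>M\<^esub>) \<or> (\<forall>x\<in>carrier M. b \<odot>\<^bsub>M\<^esub> (z \<odot>\<^bsub>M\<^esub> x) = \<zero>\<^bsub>M\<^esub>)"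
    for a b z
  proof
    fix x assume x: "x \<in> carrier M"
    have c: "a \<in> carrier R" "b \<in> carrier R" "z \<odot>\<^bsub>M\<^esub> x \<in> carrier M"
      using that x rpart_carrier smult_closed by auto
    have "(a \<otimes> b) \<odot>\<^bsub>M\<^esub> (z \<odot>\<^bsub>M\<^esub> x) = a \<odot>\<^bsub>M\<^esub> (b \<odot>\<^bsub>M\<^esub> (z \<odot>\<^bsub>M\<^esub> x))"
      "(a \<otimes> b) \<odot>\<^bsub>M\<^esub> (z \<odot>\<^bsub>M\<^esub> x) = b \<odot>\<^bsub>M\<^esub> (a \<odot>\<^bsub>M\<^esub> (z \<odot>\<^bsub>M\<^esub> x))"
      using smult_assoc[OF c(1,2,3)] smult_assoc[OF c(2,1,3)] even_comm[OF that(2) c(2)] by auto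
    then show "(a \<otimes> b) \<odot>\<^bsub>M\<^esub> (z \<odot>\<^bsub>M\<^esub> x) = \<zero>\<^bsub>M\<^esub>"
      using that(4) x c smult_r_zero by auto
  qed
  have K_zero: "\<zero> \<in> K"
    unfolding K_def using one_p smult_l_zero smult_r_zero by auto
  have K_add: "y \<oplus> z \<in> K" if yz: "y \<in> K" "z \<in> K" for y z
  proof -
    obtain a b where ab: "a \<in> rpart R 0 - p" "\<forall>x\<in>carrier M. a \<odot>\<^bsub>M\<^esub> (y \<odot>\<^bsub>M\<^esub> x) = \<zero>\<^bsub>M\<^esub>"
      "b \<in> rpart R 0 - p" "\<forall>x\<in>carrier M. b \<odot>\<^bsub>M\<^esub> (z \<odot>\<^bsub>M\<^esub> x) = \<zero>\<^bsub>M\<^esub>"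
      using yz unfolding K_def by blast
    have c: "y \<in> carrier R" "z \<in> carrier R" "a \<otimes> b \<in> carrier R"
      using yz ab rpart_carrier by (auto simp: K_def)
    have "(a \<otimes> b) \<odot>\<^bsub>M\<^esub> ((y \<oplus> z) \<odot>\<^bsub>M\<^esub> x) = \<zero>\<^bsub>M\<^esub>" if x: "x \<in> carrier M" for x
      using common[of y a b] common[of z a b] ab c x
      by (simp add: smult_l_distr smult_r_distr smult_closed)
    then show ?thesis
      unfolding K_def using pcl[OF ab(1,3)] c by blast
  qed
  \<comment> \<open>Here \<open>k\<close> counts the odd factors still to be multiplied from the
    left. The assumption that no list works puts \<open>\<one>\<close> into
    \<open>B (length fs)\<close>, and each odd factor lowers the index by one, ending in
    \<open>B 0\<close>, which lies in \<open>K\<close>.\<close>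
  define B where "B k = {z \<in> carrier R. \<forall>ys. set ys \<subseteq> rpart R 1 \<and> length ys = k \<longrightarrow>
    foldr (\<otimes>) ys \<one> \<otimes> z \<in> K}" for k
  have ysc: "set ys \<subseteq> rpart R 1 \<Longrightarrow> foldr (\<otimes>) ys \<one> \<in> carrier R" for ys
    using rpart_carrier by (intro foldr_mult_closed) blast
  have "\<exists>z. (\<forall>n. z n \<in> ideal_pow R I n \<inter> B 0) \<and>
    foldr (\<otimes>\<^bsub>gr_ring R I\<^esub>) fs \<one>\<^bsub>gr_ring R I\<^esub> = rcls z"
  proof (rule foldr_gr_representative[OF fs, of 0 "length fs"])
    have "foldr (\<otimes>) ys \<one> \<otimes> \<one> \<in> K" if ys: "set ys \<subseteq> rpart R 1" "length ys = length fs" for ys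
    proof -
      have "\<not> ann_even R (M\<lparr>carrier := (\<lambda>x. foldr (\<otimes>) ys \<one> \<odot>\<^bsub>M\<^esub> x) ` carrier M\<rparr>) \<subseteq> p"
        using none ys by (auto simp: p_def)
      then obtain a where "a \<in> rpart R 0" "a \<notin> p"
        "\<forall>x\<in>carrier M. a \<odot>\<^bsub>M\<^esub> (foldr (\<otimes>) ys \<one> \<odot>\<^bsub>M\<^esub> x) = \<zero>\<^bsub>M\<^esub>"
        by (auto simp: ann_even_def)
      then show ?thesis using ysc[OF ys(1)] by (auto simp: K_def)
    qed
    then show "\<one> \<in> B (length fs)" by (simp add: B_def)
  next
    show "\<zero> \<in> B k" for k using ysc K_zero by (auto simp: B_def)
    show "y \<oplus> z \<in> B k" if "y \<in> B k" "z \<in> B k" for k y z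
      using that K_add ysc by (auto simp: B_def r_distr)
    show "B k \<subseteq> carrier R" for k by (auto simp: B_def)
    show "y \<otimes> z \<in> B k" if yz: "y \<in> rpart R 1" "z \<in> B (Suc k)" for k y z
    proof -
      have c: "y \<in> carrier R" "z \<in> carrier R" using yz rpart_carrier by (auto simp: B_def)
      have "foldr (\<otimes>) ys \<one> \<otimes> (y \<otimes> z) \<in> K" if ys: "set ys \<subseteq> rpart R 1" "length ys = k" for ys
      proof -
        have "set ys \<subseteq> carrier R" using ys rpart_carrier by blast
        then have "foldr (\<otimes>) (ys @ [y]) \<one> \<otimes> z = foldr (\<otimes>) ys \<one> \<otimes> (y \<otimes> z)"
          using foldr_mult_append[of ys "[y]"] c ysc[OF ys(1)] by (simp add: m_assoc del: foldr_append)
        moreover have "foldr (\<otimes>) (ys @ [y]) \<one> \<otimes> z \<in> K"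
          using yz ys unfolding B_def by (auto simp del: foldr_append)
        ultimately show ?thesis by simp
      qed
      then show ?thesis using c by (simp add: B_def)
    qed
  qed simp
  then obtain z where z: "\<And>n. z n \<in> ideal_pow R I n" "\<And>n. z n \<in> B 0"
    and fold: "foldr (\<otimes>\<^bsub>gr_ring R I\<^esub>) fs \<one>\<^bsub>gr_ring R I\<^esub> = rcls z" by blast
  have zK: "z n \<in> K" for n using z(2)[of n] by (auto simp: B_def)
  have zc: "z n \<in> carrier R" for n using z(1)[THEN ideal_pow_carrier] .
  \<comment> \<open>Each component of \<open>z\<close> has its own killer. Components from
    \<open>N\<close> on are zero, so finitely many killers have to be multiplied to obtain a common
    one.\<close>
  have "\<exists>a\<in>rpart R 0 - p. \<forall>n<m. \<forall>x\<in>carrier M. a \<odot>\<^bsub>M\<^esub> (z n \<odot>\<^bsub>M\<^esub> x) = \<zero>\<^bsub>M\<^esub>" for m :: nat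
  proof (induction m)
    case 0
    then show ?case using one_p by blast
  next
    case (Suc m)
    then obtain a where a: "a \<in> rpart R 0 - p"
      "\<forall>n<m. \<forall>x\<in>carrier M. a \<odot>\<^bsub>M\<^esub> (z n \<odot>\<^bsub>M\<^esub> x) = \<zero>\<^bsub>M\<^esub>" by blast
    obtain b where b: "b \<in> rpart R 0 - p" "\<forall>x\<in>carrier M. b \<odot>\<^bsub>M\<^esub> (z m \<odot>\<^bsub>M\<^esub> x) = \<zero>\<^bsub>M\<^esub>"
      using zK[of m] unfolding K_def by blast
    have "\<forall>x\<in>carrier M. (a \<otimes> b) \<odot>\<^bsub>M\<^esub> (z n \<odot>\<^bsub>M\<^esub> x) = \<zero>\<^bsub>M\<^esub>" if "n < Suc m" for n
      using common[OF zc, of a b n] a b that by (auto simp: less_Suc_eq)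
    then show ?case using pcl[OF a(1) b(1)] by blast
  qed
  from this[of N] obtain a where a: "a \<in> rpart R 0" "a \<notin> p"
    "\<And>n x. n < N \<Longrightarrow> x \<in> carrier M \<Longrightarrow> a \<odot>\<^bsub>M\<^esub> (z n \<odot>\<^bsub>M\<^esub> x) = \<zero>\<^bsub>M\<^esub>" by blast
  have ac: "a \<in> carrier R" using rpart_carrier[OF a(1)] .
  have kill: "a \<odot>\<^bsub>M\<^esub> (z n \<odot>\<^bsub>M\<^esub> x) = \<zero>\<^bsub>M\<^esub>" if "x \<in> carrier M" for n x
    using a(3)[OF _ that, of n] z(1)[of n] ideal_pow_eq_0[of n] that ac
    by (cases "n < N") (auto simp: smult_l_zero smult_r_zero)
  have "rcls (const_seq a) \<odot>\<^bsub>gr_module R I M\<^esub> (rcls z \<odot>\<^bsub>gr_module R I M\<^esub> v) = \<zero>\<^bsub>gr_module R I M\<^esub>"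
    if "v \<in> carrier (gr_module R I M)" for v
  proof -
    obtain x where x: "x \<in> filt_seqs" "v = mcls x" using \<open>v \<in> _\<close> unfolding gr_module_carrier by blast
    note xc = filt_seqs_carrier[OF x(1)]
    have cX: "conv M z x \<in> filt_seqs"
      using conv_pow_smult[of z x] z(1) x(1) by auto
    have "a \<odot>\<^bsub>M\<^esub> conv M z x n = \<zero>\<^bsub>M\<^esub>" for n
      unfolding conv_def using zc xc ac
      by (subst smult_finsum) (auto simp: smult_closed kill)
    then show ?thesis
      using gr_module_smult[of z x] const_seq_smult[OF a(1) cX] z(1) x by (simp add: gr_module_zero)
  qed
  then have "rcls (const_seq a) \<in> P"
    using ann const_seq_even[OF a(1)] unfolding fold by (auto simp: ann_even_def gr_ring_rpart)
  then have "a \<in> p"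
    using a(1) by (simp add: p_def pull_prime_def)
  with a(2) show False by blast
qed

lemma ex_odd_params:
  assumes fin: "sm_dim R M < \<infinity>" and odd: "odd_params (gr_ring R I) (gr_module R I M) fs"
  shows "\<exists>ys. odd_params R M ys \<and> length ys = length fs"
proof -
  let ?G = "gr_ring R I" and ?N = "gr_module R I M"
  let ?T = "(\<lambda>x. foldr (\<otimes>\<^bsub>?G\<^esub>) fs \<one>\<^bsub>?G\<^esub> \<odot>\<^bsub>?N\<^esub> x) ` carrier ?N"
  have fs: "fs \<noteq> []" "set fs \<subseteq> rpart ?G 1"
    and dim: "sm_dim ?G (?N\<lparr>carrier := ?T\<rparr>) = sm_dim R M"
    using odd by (auto simp: odd_params_def sm_dim_gr)
  let ?J = "ann_even ?G (?N\<lparr>carrier := ?T\<rparr>)"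
  have "?T \<subseteq> carrier ?N" using foldr_smult_closed[OF fs(2)] by blast
  then have dim_eq: "sm_dim R M = (SUP n \<in> {n. prime_chain (even_ring ?G) ?J n}. ereal (real n))"
    using sm_dim_eq_prime_chain[OF gr_even_module] dim by metis
  show ?thesis
  proof (cases "\<exists>n. prime_chain (even_ring ?G) ?J n")
    case False
    then have empty: "{n. prime_chain (even_ring ?G) ?J n} = {}" by blast
    have bot: "sm_dim R M = -\<infinity>"
      unfolding dim_eq empty by (simp add: bot_ereal_def)
    \<comment> \<open>The dimension of \<open>M\<close> is \<open>-\<infinity>\<close> in this case,
      and zeros serve as parameters: since \<open>fs\<close> is nonempty their product is zero, and
      the zero module has dimension \<open>-\<infinity>\<close> too.\<close>
    let ?ys = "replicate (length fs) \<zero>"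
    have "foldr (\<otimes>) ?ys \<one> = \<zero>"
      using fs(1) foldr_mult_closed[of "replicate (length fs - 1) \<zero>"]
      by (cases fs) (auto simp: set_replicate_conv_if simp del: foldr_replicate split: if_splits)
    then have "(\<lambda>x. foldr (\<otimes>) ?ys \<one> \<odot>\<^bsub>M\<^esub> x) ` carrier M = {\<zero>\<^bsub>M\<^esub>}"
      using M.zero_closed smult_l_zero by auto
    then have "odd_params R M ?ys"
      using fs(1) rpart_zero bot by (auto simp: odd_params_def sm_dim_def)
    then show ?thesis by (intro exI[of _ ?ys]) simp
  next
    case True
    \<comment> \<open>Finite dimension bounds the lengths of chains, so the supremum is attained by
      a longest chain, whose smallest member is the prime to work with.\<close>
    obtain b :: nat where b: "sm_dim R M < ereal (real b)"
      using fin less_PInf_Ex_of_nat by auto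
    have bound: "n \<le> b" if "prime_chain (even_ring ?G) ?J n" for n
    proof -
      have "ereal (real n) \<le> sm_dim R M"
        unfolding dim_eq using that by (intro SUP_upper) simp
      then have "ereal (real n) < ereal (real b)"
        using b by (rule le_less_trans)
      then show ?thesis by simp
    qed
    let ?n = "GREATEST n. prime_chain (even_ring ?G) ?J n"
    have n: "prime_chain (even_ring ?G) ?J ?n"
      by (rule GreatestI_ex_nat[OF True bound])
    have max: "m \<le> ?n" if "prime_chain (even_ring ?G) ?J m" for m
      using that bound by (rule Greatest_le_nat)
    have dim_le: "sm_dim R M \<le> ereal (real ?n)"
      unfolding dim_eq using max by (intro SUP_least) auto
    obtain P where P: "primeideal P (even_ring ?G)" "?J \<subseteq> P" "\<And>K. K \<subseteq> P \<Longrightarrow> prime_chain (even_ring ?G) K ?n"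
      using prime_chain_start[OF n] by blast
    obtain ys where ys: "length ys = length fs" "set ys \<subseteq> rpart R 1"
      "ann_even R (M\<lparr>carrier := (\<lambda>x. foldr (\<otimes>) ys \<one> \<odot>\<^bsub>M\<^esub> x) ` carrier M\<rparr>) \<subseteq> pull_prime P"
      using odd_list_below_prime[OF fs(2) P(1,2)] by blast
    let ?S = "(\<lambda>x. foldr (\<otimes>) ys \<one> \<odot>\<^bsub>M\<^esub> x) ` carrier M"
    have "foldr (\<otimes>) ys \<one> \<in> carrier R"
      using ys(2) rpart_carrier by (intro foldr_mult_closed) blast
    then have S: "?S \<subseteq> carrier M" using smult_closed by blast
    \<comment> \<open>The chain is contracted without loss of length. Its smallest member becomes
      \<open>pull_prime P\<close>, so all members lie above the annihilator of
      \<open>?S\<close>.\<close>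
    have "prime_chain (even_ring R) (pull_prime P) ?n"
      using P(3)[OF subset_refl]
      by (rule prime_chain_transfer[where \<phi> = pull_prime]) (simp_all add: pull_primeideal pull_mono pull_strict_mono)
    then have chain: "prime_chain (even_ring R) (ann_even R (M\<lparr>carrier := ?S\<rparr>)) ?n"
      using ys(3) by (rule prime_chain_antimono)
    have "ereal (real ?n) \<le> sm_dim R (M\<lparr>carrier := ?S\<rparr>)"
      unfolding sm_dim_prime_chain[OF S] using chain by (intro SUP_upper) simp
    \<comment> \<open>Conversely, a smaller set has a larger annihilator and fewer primes above
      it.\<close>
    moreover have "sm_dim R (M\<lparr>carrier := ?S\<rparr>) \<le> sm_dim R (M\<lparr>carrier := carrier M\<rparr>)"
    proof -
      have "ann_even R (M\<lparr>carrier := carrier M\<rparr>) \<subseteq> ann_even R (M\<lparr>carrier := ?S\<rparr>)"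
        using S by (auto simp: ann_even_def)
      then show ?thesis
        unfolding sm_dim_prime_chain[OF S] sm_dim_prime_chain[OF subset_refl]
        by (intro SUP_subset_mono) (auto intro: prime_chain_antimono)
    qed
    ultimately have "sm_dim R (M\<lparr>carrier := ?S\<rparr>) = sm_dim R M"
      using dim_le by simp
    then have "odd_params R M ys"
      using ys fs(1) by (auto simp: odd_params_def)
    then show ?thesis using ys(1) by blast
  qed
qed

end

theorem lemma5p1:
  fixes R :: "('a, 'm) super_ring_scheme" and M :: "('a, 'b, 'n) super_module_scheme"
    and I :: "'a set"
  assumes "noetherian_super_ring R"
    and "Kdim (even_ring R) < \<infinity>"
    and "superideal I R"
    and "I \<subseteq> nilrad R"
    and "super_module R M"
    and "carrier M \<noteq> {\<zero>\<^bsub>M\<^esub>}"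
    and "fin_gen R M"
  shows "sdim0 R M = sdim0 (gr_ring R I) (gr_module R I M) \<and>
         sdim1 R M \<ge> sdim1 (gr_ring R I) (gr_module R I M)"
proof -
  interpret S: super_module R M by fact
  obtain N where N: "ideal_pow R I N = {\<zero>\<^bsub>R\<^esub>}"
    using noetherian_super_ring.ideal_pow_nilpotent[OF assms(1,3,4)] by blast
  have "nilpotent_ideal R I N"
    using assms(3) N S.R.ring_axioms
    by (auto simp: nilpotent_ideal_def nilpotent_ideal_axioms_def superideal_def)
  then have "super_nilpotent_ideal R I N"
    using S.R.super_ring_axioms by (intro super_nilpotent_ideal.intro)
  then have "gr_filtered_module R M I N"
    using assms(5) by (intro gr_filtered_module.intro)
  then interpret gr_filtered_module R M I N .
  \<comment> \<open>Chains above the annihilator are in particular chains of primes of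
    \<open>R_0\<close>.\<close>
  have "sm_dim R M \<le> Kdim (even_ring R)"
    using sm_dim_prime_chain[OF subset_refl] unfolding Kdim_eq_prime_chain
    by (auto intro!: SUP_subset_mono intro: prime_chain_antimono)
  then have "sm_dim R M < \<infinity>"
    using assms(2) by (rule le_less_trans)
  \<comment> \<open>Every length occurring on the graded side also occurs for \<open>M\<close>, so
    the suprema compare without knowing that they are attained.\<close>
  then have "sdim1 (gr_ring R I) (gr_module R I M) \<le> sdim1 R M"
    unfolding sdim1_def
    by (intro SUP_least) (metis (mono_tags, lifting) SUP_upper ex_odd_params mem_Collect_eq)
  then show ?thesis
    by (simp add: sdim0_def sm_dim_gr)
qed

end
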